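(* Let $\mathbb{F}$ be any field. For all integers $n>1000$ and all real $\alpha\in(0,0.1)$, there is an $n\times n$ tropical matrix $A$ (with entries in $\overline{\mathbb{R}}=\mathbb{R}\cup\{\infty\}$) such that $$\operatorname{tropical\ rank}(A)\leqslant\frac{4\sqrt{n}\ln n}{\alpha^2}\quad\text{and}\quad \operatorname{Kapranov\ rank}(A)\geqslant n(1-\alpha),$$ where the Kapranov rank is taken over $\mathbb{F}$.
   Context: Tropical semiring: $\overline{\mathbb{R}}=\mathbb{R}\cup\{\infty\}$ with tropical addition $\min$ and tropical multiplication $+$. For a square tropical matrix $B$ of size $m$, say $B$ is tropically non-singular if the minimum $\min_{\sigma\in S_m}\sum_{p=1}^m B(p|\sigma(p))$ is finite and attained by exactly one permutation $\sigma$; otherwise it is tropically singular. The tropical rank of a tropical matrix is the largest size of a tropically non-singular square submatrix. Let $\mathcal{F}=\mathbb{F}\{\{t\}\}$ be the field of generalized Puiseux series: formal sums $\sum_{e\in\mathbb{R}}a_et^e$ with $a_e\in\mathbb{F}$ whose support $\{e:a_e\neq 0\}$ is well-ordered; define $\deg a=\min\operatorname{Supp}(a)$ and $\deg 0=\infty$. The Kapranov rank (over $\mathbb{F}$) of a tropical matrix $A$ is the smallest rank of a matrix $L$ with entries in $\mathcal{F}$ such that $\deg L(p|q)=A(p|q)$ for all entries. *)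

theory Defs
  imports
    Complex_Main
    "HOL-Library.Extended_Real"
    "Jordan_Normal_Form.DL_Rank"
    "Jordan_Normal_Form.DL_Submatrix"
begin

section \<open>Well-ordered sets of reals\<close>

definition well_ordered :: "real set \<Rightarrow> bool" where
  "well_ordered S \<longleftrightarrow> (\<forall>T\<subseteq>S. T \<noteq> {} \<longrightarrow> (\<exists>m\<in>T. \<forall>x\<in>T. m \<le> x))"

lemma well_ordered_least:
  "well_ordered S \<Longrightarrow> T \<subseteq> S \<Longrightarrow> T \<noteq> {} \<Longrightarrow> \<exists>m\<in>T. \<forall>x\<in>T. m \<le> x"
  unfolding well_ordered_def by blast

lemma well_ordered_subset: "well_ordered S \<Longrightarrow> T \<subseteq> S \<Longrightarrow> well_ordered T"
  unfolding well_ordered_def by blast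

lemma well_ordered_empty [simp]: "well_ordered {}"
  unfolding well_ordered_def by blast

lemma well_ordered_Un:
  assumes "well_ordered S" "well_ordered T"
  shows "well_ordered (S \<union> T)"
  unfolding well_ordered_def
proof (intro allI impI)
  fix U assume U: "U \<subseteq> S \<union> T" "U \<noteq> {}"
  show "\<exists>m\<in>U. \<forall>x\<in>U. m \<le> x"
  proof (cases "U \<inter> S = {} \<or> U \<inter> T = {}")
    case True
    then have "U \<subseteq> S \<or> U \<subseteq> T" using U by blast
    then show ?thesis using assms U unfolding well_ordered_def by blast
  next
    case False
    obtain m where m: "m \<in> U \<inter> S" "\<And>x. x \<in> U \<inter> S \<Longrightarrow> m \<le> x"
      using well_ordered_least[OF assms(1), of "U \<inter> S"] False by blast
    obtain k where k: "k \<in> U \<inter> T" "\<And>x. x \<in> U \<inter> T \<Longrightarrow> k \<le> x"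
      using well_ordered_least[OF assms(2), of "U \<inter> T"] False by blast
    have "min m k \<in> U" using m k by (auto simp: min_def)
    moreover have "min m k \<le> x" if "x \<in> U" for x
      using that U(1) m(2)[of x] k(2)[of x] by (auto simp: min_le_iff_disj)
    ultimately show ?thesis by blast
  qed
qed

lemma well_ordered_singleton [simp]: "well_ordered {x}"
  unfolding well_ordered_def by auto

lemma well_ordered_no_descent:
  assumes "well_ordered S" "range f \<subseteq> S"
  shows "\<not> (\<forall>n::nat. f (Suc n) < f n)"
proof
  assume dec: "\<forall>n. f (Suc n) < f n"
  obtain m where m: "m \<in> range f" "\<And>x. x \<in> range f \<Longrightarrow> m \<le> x"
    using well_ordered_least[OF assms] by blast
  then obtain n where "m = f n" by blast
  then have "f n \<le> f (Suc n)" using m(2) by blast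
  then show False using dec leD by blast
qed

lemma well_ordered_incseq_sub:
  fixes f :: "nat \<Rightarrow> real"
  assumes "well_ordered S" "range f \<subseteq> S"
  obtains g :: "nat \<Rightarrow> nat" where "strict_mono g" "\<And>m n. m \<le> n \<Longrightarrow> f (g m) \<le> f (g n)"
proof -
  obtain h where h: "strict_mono h" "monoseq (\<lambda>n. f (h n))"
    using seq_monosub by blast
  from h(2) consider "\<forall>m. \<forall>n\<ge>m. f (h m) \<le> f (h n)" | "\<forall>m. \<forall>n\<ge>m. f (h n) \<le> f (h m)"
    unfolding monoseq_def by blast
  then show ?thesis
  proof cases
    case 1
    then show ?thesis using that h(1) by blast
  next
    case 2
    have "range (\<lambda>n. f (h n)) \<subseteq> S" using assms(2) by blast
    from well_ordered_least[OF assms(1) this] obtain m where m: "m \<in> range (\<lambda>n. f (h n))"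
      "\<And>x. x \<in> range (\<lambda>n. f (h n)) \<Longrightarrow> m \<le> x"
      by blast
    then obtain N where N: "m = f (h N)" by blast
    have eq: "f (h (n + N)) = m" for n
      using 2 m(2)[of "f (h (n + N))"] N by (simp add: antisym)
    have "strict_mono (\<lambda>n. h (n + N))"
      using h(1) by (simp add: strict_mono_def)
    then show ?thesis using that[of "\<lambda>n. h (n + N)"] eq by simp
  qed
qed

lemma well_ordered_plus:
  assumes S: "well_ordered S" and T: "well_ordered T"
  shows "well_ordered {x + y |x y. x \<in> S \<and> y \<in> T}"
proof (rule ccontr)
  assume "\<not> ?thesis"
  then obtain U where U: "U \<subseteq> {x + y |x y. x \<in> S \<and> y \<in> T}" "U \<noteq> {}"
    "\<And>m. m \<in> U \<Longrightarrow> \<exists>x\<in>U. x < m"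
    unfolding well_ordered_def by (auto simp: not_le)
  have "\<exists>f. \<forall>n::nat. f n \<in> U \<and> f (Suc n) < f n"
  proof (rule dependent_nat_choice[where P = "\<lambda>_ x. x \<in> U" and Q = "\<lambda>_ x y. y < x"])
    show "\<exists>x. x \<in> U" using U(2) by blast
    show "\<exists>y. y \<in> U \<and> y < x" if "x \<in> U" for x using U(3)[OF that] by blast
  qed
  then obtain f where f: "\<And>n::nat. f n \<in> U" "\<And>n. f (Suc n) < f n" by blast
  have "\<forall>n. \<exists>x y. x \<in> S \<and> y \<in> T \<and> f n = x + y" using f(1) U(1) by blast
  then obtain a b where ab: "\<And>n. a n \<in> S" "\<And>n. b n \<in> T" "\<And>n. f n = a n + b n" by metis
  obtain g :: "nat \<Rightarrow> nat" where g: "strict_mono g" "\<And>m n. m \<le> n \<Longrightarrow> a (g m) \<le> a (g n)"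
    using well_ordered_incseq_sub[OF S, of a] ab(1) by blast
  have fdec: "f n < f m" if "m < n" for m n
    using lift_Suc_mono_less[of "\<lambda>n. - f n" m n] f(2) that by simp
  have "\<forall>n. b (g (Suc n)) < b (g n)"
  proof
    fix n
    have "f (g (Suc n)) < f (g n)" using fdec g(1) by (simp add: strict_mono_def)
    moreover have "a (g n) \<le> a (g (Suc n))" using g(2) by simp
    ultimately show "b (g (Suc n)) < b (g n)" using ab(3) by (smt (verit))
  qed
  then show False using well_ordered_no_descent[OF T, of "\<lambda>n. b (g n)"] ab(2) by blast
qed

lemma well_ordered_finite_decomp:
  assumes S: "well_ordered S" and T: "well_ordered T"
  shows "finite {x. x \<in> S \<and> e - x \<in> T}"
proof -
  define X where "X = {x. x \<in> S \<and> e - x \<in> T}"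
  have max: "\<exists>m\<in>Y. \<forall>x\<in>Y. x \<le> m" if Y: "Y \<subseteq> X" "Y \<noteq> {}" for Y
  proof -
    have "(\<lambda>x. e - x) ` Y \<subseteq> T" using Y X_def by blast
    then obtain m where m: "m \<in> (\<lambda>x. e - x) ` Y" "\<And>x. x \<in> (\<lambda>x. e - x) ` Y \<Longrightarrow> m \<le> x"
      using well_ordered_least[OF T, of "(\<lambda>x. e - x) ` Y"] Y(2) by blast
    then obtain k where k: "k \<in> Y" "m = e - k" by blast
    have "x \<le> k" if "x \<in> Y" for x using m(2)[of "e - x"] k(2) that by simp
    then show ?thesis using k(1) by blast
  qed
  have fin: "finite {y \<in> X. y \<le> x}" if "x \<in> X" for x
  proof (rule ccontr)
    assume "\<not> ?thesis"
    then have ne: "{x \<in> X. infinite {y \<in> X. y \<le> x}} \<noteq> {}" using that by blast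
    have "{x \<in> X. infinite {y \<in> X. y \<le> x}} \<subseteq> S" using X_def by blast
    from well_ordered_least[OF S this ne] obtain m where m: "m \<in> {x \<in> X. infinite {y \<in> X. y \<le> x}}"
      "\<And>z. z \<in> {x \<in> X. infinite {y \<in> X. y \<le> x}} \<Longrightarrow> m \<le> z"
      by blast
    have split: "{y \<in> X. y \<le> m} = insert m {y \<in> X. y < m}" using m(1) by auto
    then have inf: "infinite {y \<in> X. y < m}" using m(1) by auto
    then have "{y \<in> X. y < m} \<noteq> {}" by (metis finite.emptyI)
    then obtain k where k: "k \<in> {y \<in> X. y < m}" "\<forall>x\<in>{y \<in> X. y < m}. x \<le> k"
      using max[of "{y \<in> X. y < m}"] by blast
    then have "{y \<in> X. y < m} \<subseteq> {y \<in> X. y \<le> k}" by blast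
    then have "infinite {y \<in> X. y \<le> k}" using inf finite_subset by blast
    then show False using m(2)[of k] k(1) by auto
  qed
  have "finite X"
  proof (cases "X = {}")
    case False
    then obtain m where "m \<in> X" "\<forall>x\<in>X. x \<le> m" using max[of X] by blast
    then have "X = {y \<in> X. y \<le> m}" by blast
    then show ?thesis using fin[OF \<open>m \<in> X\<close>] by simp
  qed simp
  then show ?thesis unfolding X_def .
qed

section \<open>Generalized Puiseux series\<close>

typedef (overloaded) 'a gpuiseux = "{f :: real \<Rightarrow> 'a::zero. well_ordered {e. f e \<noteq> 0}}"
  morphisms gp_coeff Abs_gpuiseux
  by (rule exI[of _ "\<lambda>_. 0"]) simp

setup_lifting type_definition_gpuiseux

definition gp_supp :: "'a::zero gpuiseux \<Rightarrow> real set" where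
  "gp_supp a = {e. gp_coeff a e \<noteq> 0}"

lemma well_ordered_gp_supp: "well_ordered (gp_supp a)"
  using gp_coeff[of a] by (simp add: gp_supp_def)

lemma gp_eqI: "(\<And>e. gp_coeff a e = gp_coeff b e) \<Longrightarrow> a = b"
  by (metis ext gp_coeff_inject)

lemma gp_coeff_Abs: "well_ordered {e. f e \<noteq> 0} \<Longrightarrow> gp_coeff (Abs_gpuiseux f) = f"
  by (simp add: Abs_gpuiseux_inverse)

instantiation gpuiseux :: (zero) zero
begin
lift_definition zero_gpuiseux :: "'a gpuiseux" is "\<lambda>_. 0" by simp
instance ..
end

instantiation gpuiseux :: ("{zero, one}") one
begin
lift_definition one_gpuiseux :: "'a gpuiseux" is "\<lambda>e. if e = 0 then 1 else 0"
  by (rule well_ordered_subset[of "{0}"]) auto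
instance ..
end

lemma well_ordered_supp_add:
  fixes f g :: "real \<Rightarrow> 'a::comm_monoid_add"
  assumes "well_ordered {e. f e \<noteq> 0}" "well_ordered {e. g e \<noteq> 0}"
  shows "well_ordered {e. f e + g e \<noteq> 0}"
  by (rule well_ordered_subset[OF well_ordered_Un[OF assms]]) auto

instantiation gpuiseux :: (comm_monoid_add) comm_monoid_add
begin
lift_definition plus_gpuiseux :: "'a gpuiseux \<Rightarrow> 'a gpuiseux \<Rightarrow> 'a gpuiseux"
  is "\<lambda>f g e. f e + g e" by (rule well_ordered_supp_add)
instance by standard (transfer; simp add: ac_simps fun_eq_iff)+
end

instantiation gpuiseux :: (ab_group_add) ab_group_add
begin
lift_definition uminus_gpuiseux :: "'a gpuiseux \<Rightarrow> 'a gpuiseux"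
  is "\<lambda>f e. - f e" by simp
lift_definition minus_gpuiseux :: "'a gpuiseux \<Rightarrow> 'a gpuiseux \<Rightarrow> 'a gpuiseux"
  is "\<lambda>f g e. f e - g e"
  subgoal for f g using well_ordered_supp_add[of f "\<lambda>e. - g e"] by simp
  done
instance by standard (transfer; simp)+
end

lemma gp_coeff_zero [simp]: "gp_coeff 0 e = 0" by transfer simp
lemma gp_coeff_one: "gp_coeff 1 e = (if e = 0 then 1 else 0)" by transfer simp
lemma gp_coeff_plus [simp]: "gp_coeff (a + b) e = gp_coeff a e + gp_coeff b e"
  by transfer simp
lemma gp_coeff_uminus [simp]: "gp_coeff (- a) e = - gp_coeff a e" by transfer simp
lemma gp_coeff_minus [simp]: "gp_coeff (a - b) e = gp_coeff a e - gp_coeff b e"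
  by transfer simp
lemma gp_coeff_sum: "gp_coeff (sum f A) e = (\<Sum>x\<in>A. gp_coeff (f x) e)"
  by (induction A rule: infinite_finite_induct) auto

definition gp_conv :: "(real \<Rightarrow> 'a::comm_ring_1) \<Rightarrow> (real \<Rightarrow> 'a) \<Rightarrow> real \<Rightarrow> 'a" where
  "gp_conv f g e = (\<Sum>x | f x \<noteq> 0 \<and> g (e - x) \<noteq> 0. f x * g (e - x))"

lemma gp_conv_superset:
  assumes "well_ordered S" "well_ordered T" "{e. f e \<noteq> 0} \<subseteq> S" "{e. g e \<noteq> 0} \<subseteq> T"
  shows "gp_conv f g e = (\<Sum>x | x \<in> S \<and> e - x \<in> T. f x * g (e - x))"
  unfolding gp_conv_def
  by (rule sum.mono_neutral_left) (use assms well_ordered_finite_decomp in auto)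

lemma gp_conv_supp:
  "{e. gp_conv f g e \<noteq> 0} \<subseteq> {x + y |x y. x \<in> {e. f e \<noteq> 0} \<and> y \<in> {e. g e \<noteq> 0}}"
proof
  fix e assume "e \<in> {e. gp_conv f g e \<noteq> 0}"
  then have "{x. f x \<noteq> 0 \<and> g (e - x) \<noteq> 0} \<noteq> {}"
    by (auto simp: gp_conv_def simp del: Collect_empty_eq)
  then obtain x where "f x \<noteq> 0" "g (e - x) \<noteq> 0" by blast
  then have "e = x + (e - x) \<and> x \<in> {e. f e \<noteq> 0} \<and> e - x \<in> {e. g e \<noteq> 0}" by simp
  then show "e \<in> {x + y |x y. x \<in> {e. f e \<noteq> 0} \<and> y \<in> {e. g e \<noteq> 0}}" by blast
qed

instantiation gpuiseux :: (comm_ring_1) comm_ring_1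
begin

lift_definition times_gpuiseux :: "'a gpuiseux \<Rightarrow> 'a gpuiseux \<Rightarrow> 'a gpuiseux" is gp_conv
  by (rule well_ordered_subset[OF well_ordered_plus gp_conv_supp])

lemma gp_coeff_times: "gp_coeff (a * b) = gp_conv (gp_coeff a) (gp_coeff b)"
  by transfer simp

lemma gp_coeff_times_superset:
  assumes "well_ordered S" "well_ordered T" "gp_supp a \<subseteq> S" "gp_supp b \<subseteq> T"
  shows "gp_coeff (a * b) e = (\<Sum>x | x \<in> S \<and> e - x \<in> T. gp_coeff a x * gp_coeff b (e - x))"
  unfolding gp_coeff_times
  by (rule gp_conv_superset) (use assms in \<open>auto simp: gp_supp_def\<close>)

lemma gp_supp_times: "gp_supp (a * b) \<subseteq> {x + y |x y. x \<in> gp_supp a \<and> y \<in> gp_supp b}"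
  unfolding gp_supp_def gp_coeff_times by (rule gp_conv_supp)

lemma gp_times_commute: "a * b = b * (a :: 'a gpuiseux)"
proof (rule gp_eqI)
  fix e
  show "gp_coeff (a * b) e = gp_coeff (b * a) e"
    unfolding gp_coeff_times gp_conv_def
    by (rule sum.reindex_bij_witness[of _ "\<lambda>x. e - x" "\<lambda>x. e - x"]) (auto simp: mult.commute)
qed

lemma gp_times_assoc: "(a * b) * c = a * (b * (c :: 'a gpuiseux))"
proof (rule gp_eqI)
  fix e
  let ?A = "gp_supp a" and ?B = "gp_supp b" and ?C = "gp_supp c"
  let ?AB = "{x + y |x y. x \<in> ?A \<and> y \<in> ?B}" and ?BC = "{x + y |x y. x \<in> ?B \<and> y \<in> ?C}"
  note wo = well_ordered_gp_supp
  note wo2 = well_ordered_plus[OF wo wo]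
  have "gp_coeff ((a * b) * c) e =
      (\<Sum>s | s \<in> ?AB \<and> e - s \<in> ?C. gp_coeff (a * b) s * gp_coeff c (e - s))"
    by (rule gp_coeff_times_superset[OF wo2 wo gp_supp_times order_refl])
  also have "\<dots> = (\<Sum>s | s \<in> ?AB \<and> e - s \<in> ?C. \<Sum>x | x \<in> ?A \<and> s - x \<in> ?B.
      gp_coeff a x * gp_coeff b (s - x) * gp_coeff c (e - s))"
    by (simp only: gp_coeff_times_superset[OF wo wo order_refl order_refl, of a b] sum_distrib_right)
  also have "\<dots> = (\<Sum>(s, x) \<in> (SIGMA s : {s. s \<in> ?AB \<and> e - s \<in> ?C}. {x. x \<in> ?A \<and> s - x \<in> ?B}).
      gp_coeff a x * gp_coeff b (s - x) * gp_coeff c (e - s))"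
    by (rule sum.Sigma; (intro ballI)?;
        rule well_ordered_finite_decomp[OF wo2 wo] well_ordered_finite_decomp[OF wo wo])
  also have "\<dots> = (\<Sum>(x, y) \<in> (SIGMA x : {x. x \<in> ?A \<and> e - x \<in> ?BC}. {y. y \<in> ?B \<and> e - x - y \<in> ?C}).
      gp_coeff a x * (gp_coeff b y * gp_coeff c (e - x - y)))"
  proof (rule sum.reindex_bij_witness[of _ "\<lambda>(x, y). (x + y, x)" "\<lambda>(s, x). (x, s - x)"], goal_cases)
    case (2 p)
    obtain s x where p: "p = (s, x)" by (cases p)
    have h: "e - s \<in> ?C" "x \<in> ?A" "s - x \<in> ?B" using 2 p by auto
    have "e - x = (s - x) + (e - s)" by simp
    then have "e - x \<in> ?BC" using h by blast
    then show ?case using p h by simp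
  next
    case (4 p)
    obtain x y where p: "p = (x, y)" by (cases p)
    have h: "x \<in> ?A" "y \<in> ?B" "e - x - y \<in> ?C" using 4 p by auto
    have "x + y \<in> ?AB" using h by blast
    then show ?case using p h by (simp add: diff_diff_eq)
  next
    case (5 p)
    obtain s x where p: "p = (s, x)" by (cases p)
    have "e - x - (s - x) = e - s" by simp
    then show ?case using p by (simp only: prod.case mult.assoc)
  qed auto
  also have "\<dots> = (\<Sum>x | x \<in> ?A \<and> e - x \<in> ?BC. \<Sum>y | y \<in> ?B \<and> e - x - y \<in> ?C.
      gp_coeff a x * (gp_coeff b y * gp_coeff c (e - x - y)))"
    by (rule sum.Sigma[symmetric]; (intro ballI)?;
        rule well_ordered_finite_decomp[OF wo wo2] well_ordered_finite_decomp[OF wo wo])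
  also have "\<dots> = (\<Sum>x | x \<in> ?A \<and> e - x \<in> ?BC. gp_coeff a x * gp_coeff (b * c) (e - x))"
    by (simp only: gp_coeff_times_superset[OF wo wo order_refl order_refl, of b c] sum_distrib_left)
  also have "\<dots> = gp_coeff (a * (b * c)) e"
    by (rule gp_coeff_times_superset[OF wo wo2 order_refl gp_supp_times, symmetric])
  finally show "gp_coeff ((a * b) * c) e = gp_coeff (a * (b * c)) e" .
qed

lemma gp_one_times: "1 * a = (a :: 'a gpuiseux)"
proof (rule gp_eqI)
  fix e
  have "gp_coeff (1 * a) e =
      (\<Sum>x | x \<in> {0} \<and> e - x \<in> gp_supp a. gp_coeff 1 x * gp_coeff a (e - x))"
    by (rule gp_coeff_times_superset)
      (use well_ordered_gp_supp[of a] in \<open>auto simp: gp_supp_def gp_coeff_one split: if_splits\<close>)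
  also have "\<dots> = gp_coeff a e"
  proof (cases "e \<in> gp_supp a")
    case True
    then have "{x. x \<in> {0} \<and> e - x \<in> gp_supp a} = {0}" by auto
    then show ?thesis by (simp only:) (simp add: gp_coeff_one)
  next
    case False
    then have "{x. x \<in> {0} \<and> e - x \<in> gp_supp a} = {}" by auto
    then show ?thesis using False by (simp only:) (simp add: gp_supp_def)
  qed
  finally show "gp_coeff (1 * a) e = gp_coeff a e" .
qed

lemma gp_distrib: "(a + b) * c = a * c + b * (c :: 'a gpuiseux)"
proof (rule gp_eqI)
  fix e
  let ?S = "gp_supp a \<union> gp_supp b" and ?T = "gp_supp c"
  note wo = well_ordered_gp_supp
  have "gp_supp (a + b) \<subseteq> ?S" by (auto simp: gp_supp_def)
  then show "gp_coeff ((a + b) * c) e = gp_coeff (a * c + b * c) e"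
    using gp_coeff_times_superset[OF well_ordered_Un[OF wo wo] wo, of "a + b" a b c c e]
      gp_coeff_times_superset[OF well_ordered_Un[OF wo wo] wo, of a a b c c e]
      gp_coeff_times_superset[OF well_ordered_Un[OF wo wo] wo, of b a b c c e]
    by (simp add: distrib_right sum.distrib)
qed

instance
proof
  fix a b c :: "'a gpuiseux"
  show "a * b * c = a * (b * c)" by (rule gp_times_assoc)
  show "a * b = b * a" by (rule gp_times_commute)
  show "1 * a = a" by (rule gp_one_times)
  show "(a + b) * c = a * c + b * c" by (rule gp_distrib)
  show "(0 :: 'a gpuiseux) \<noteq> 1"
  proof
    assume "(0 :: 'a gpuiseux) = 1"
    then have "gp_coeff (0 :: 'a gpuiseux) 0 = gp_coeff 1 0" by simp
    then show False by (simp add: gp_coeff_one)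
  qed
qed

end

lift_definition gp_monom :: "'a::zero \<Rightarrow> real \<Rightarrow> 'a gpuiseux" is
  "\<lambda>c e x. if x = e then c else 0"
  by (rule well_ordered_subset[of "{e}" for e]) auto

lemma gp_coeff_monom: "gp_coeff (gp_monom c e) x = (if x = e then c else 0)"
  by transfer simp

lemma gp_coeff_monom_times:
  fixes a :: "'a::comm_ring_1 gpuiseux"
  shows "gp_coeff (gp_monom c d * a) e = c * gp_coeff a (e - d)"
proof -
  have "gp_coeff (gp_monom c d * a) e =
      (\<Sum>x | x \<in> {d} \<and> e - x \<in> gp_supp a. gp_coeff (gp_monom c d) x * gp_coeff a (e - x))"
    by (rule gp_coeff_times_superset)
      (use well_ordered_gp_supp[of a] in \<open>auto simp: gp_supp_def gp_coeff_monom split: if_splits\<close>)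
  also have "\<dots> = c * gp_coeff a (e - d)"
  proof (cases "e - d \<in> gp_supp a")
    case True
    then have "{x. x \<in> {d} \<and> e - x \<in> gp_supp a} = {d}" by auto
    then show ?thesis by (simp only:) (simp add: gp_coeff_monom)
  next
    case False
    then have "{x. x \<in> {d} \<and> e - x \<in> gp_supp a} = {}" by auto
    then show ?thesis using False by (simp only:) (simp add: gp_supp_def)
  qed
  finally show ?thesis .
qed

lemma gp_supp_power:
  fixes u :: "'a::comm_ring_1 gpuiseux"
  assumes "\<And>x. x \<in> gp_supp u \<Longrightarrow> d \<le> x" "x \<in> gp_supp (u ^ n)"
  shows "real n * d \<le> x"
  using assms(2)
proof (induction n arbitrary: x)
  case 0
  then show ?case by (simp add: gp_supp_def gp_coeff_one split: if_splits)
next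
  case (Suc n)
  then have "x \<in> {x + y |x y. x \<in> gp_supp u \<and> y \<in> gp_supp (u ^ n)}"
    using gp_supp_times[of u "u ^ n"] by auto
  then obtain y z where "x = y + z" "y \<in> gp_supp u" "z \<in> gp_supp (u ^ n)" by blast
  then show ?case using Suc.IH[of z] assms(1)[of y] by (simp add: algebra_simps)
qed

lemma gp_times_cong_le:
  fixes a b c :: "'a::comm_ring_1 gpuiseux"
  assumes "\<And>x. x \<in> gp_supp a \<Longrightarrow> 0 \<le> x" "\<And>y. y \<le> e \<Longrightarrow> gp_coeff b y = gp_coeff c y"
  shows "gp_coeff (a * b) e = gp_coeff (a * c) e"
  unfolding gp_coeff_times gp_conv_def
  by (rule sum.cong) (use assms in \<open>auto simp: gp_supp_def\<close>)

text \<open>As the exponents are real, the geometric series of a series with positive support is a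
  finite sum in every degree.\<close>

lemma gp_inverse_one_minus:
  fixes u :: "'a::comm_ring_1 gpuiseux"
  assumes d: "d > 0" "\<And>x. x \<in> gp_supp u \<Longrightarrow> d \<le> x"
  shows "\<exists>v. (1 - u) * v = 1"
proof -
  define N :: "real \<Rightarrow> nat" where "N x = nat \<lceil>x / d\<rceil> + 1" for x
  have N: "x < real n * d" if "N x \<le> n" for x n
  proof -
    have "x / d < real n" using that unfolding N_def by linarith
    then show ?thesis using d(1) by (simp add: divide_less_eq)
  qed
  have Nmono: "N y \<le> N x" if "y \<le> x" for x y
  proof -
    have "y / d \<le> x / d" using that d(1) by (simp add: divide_right_mono)
    then show ?thesis unfolding N_def by (intro add_right_mono nat_mono ceiling_mono)
  qed
  have zero: "gp_coeff (u ^ n) x = 0" if "N x \<le> n" for x n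
  proof (rule ccontr)
    assume "gp_coeff (u ^ n) x \<noteq> 0"
    then have "real n * d \<le> x" using gp_supp_power[of u d x n] d(2) by (simp add: gp_supp_def)
    then show False using N[OF that] by simp
  qed
  have stable: "gp_coeff (\<Sum>i<n. u ^ i) x = gp_coeff (\<Sum>i<N x. u ^ i) x" if "N x \<le> n" for x n
    unfolding gp_coeff_sum
    by (rule sum.mono_neutral_right) (use that zero in auto)
  define g where "g x = gp_coeff (\<Sum>i<N x. u ^ i) x" for x
  have "well_ordered {x. g x \<noteq> 0}"
    unfolding well_ordered_def
  proof (intro allI impI)
    fix T assume T: "T \<subseteq> {x. g x \<noteq> 0}" "T \<noteq> {}"
    then obtain t where t: "t \<in> T" by blast
    have "{x \<in> T. x \<le> t} \<subseteq> gp_supp (\<Sum>i<N t. u ^ i)"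
    proof
      fix x assume "x \<in> {x \<in> T. x \<le> t}"
      then have "g x \<noteq> 0" "x \<le> t" using T by auto
      then show "x \<in> gp_supp (\<Sum>i<N t. u ^ i)"
        using stable[OF Nmono, of x t] by (simp add: gp_supp_def g_def)
    qed
    moreover have "{x \<in> T. x \<le> t} \<noteq> {}" using t by blast
    ultimately have "\<exists>m\<in>{x \<in> T. x \<le> t}. \<forall>x\<in>{x \<in> T. x \<le> t}. m \<le> x"
      by (rule well_ordered_least[OF well_ordered_gp_supp])
    then obtain m where m: "m \<in> {x \<in> T. x \<le> t}" "\<And>x. x \<in> {x \<in> T. x \<le> t} \<Longrightarrow> m \<le> x"
      by blast
    have "m \<le> x" if "x \<in> T" for x
      using m(1) m(2)[of x] that by (cases "x \<le> t") auto
    then show "\<exists>m\<in>T. \<forall>x\<in>T. m \<le> x" using m(1) by blast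
  qed
  then have g: "gp_coeff (Abs_gpuiseux g) = g" by (rule gp_coeff_Abs)
  have "(1 - u) * Abs_gpuiseux g = 1"
  proof (rule gp_eqI)
    fix e
    have "gp_coeff ((1 - u) * Abs_gpuiseux g) e = gp_coeff ((1 - u) * (\<Sum>i<N e. u ^ i)) e"
    proof (rule gp_times_cong_le)
      fix x assume "x \<in> gp_supp (1 - u)"
      then have "x = 0 \<or> x \<in> gp_supp u" by (auto simp: gp_supp_def gp_coeff_one split: if_splits)
      then show "0 \<le> x" using d by force
    next
      fix y assume "y \<le> e"
      then show "gp_coeff (Abs_gpuiseux g) y = gp_coeff (\<Sum>i<N e. u ^ i) y"
        unfolding g using stable[OF Nmono, of y e] by (simp add: g_def)
    qed
    also have "\<dots> = gp_coeff (1 - u ^ N e) e" by (simp only: one_diff_power_eq)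
    also have "\<dots> = gp_coeff 1 e" using zero[of e "N e"] by simp
    finally show "gp_coeff ((1 - u) * Abs_gpuiseux g) e = gp_coeff 1 e" .
  qed
  then show ?thesis by blast
qed

lemma gp_inverse_exists:
  fixes a :: "'a::field gpuiseux"
  assumes "a \<noteq> 0"
  shows "\<exists>b. a * b = 1"
proof -
  have "gp_supp a \<noteq> {}" using assms gp_eqI[of a 0] by (auto simp: gp_supp_def)
  then obtain m where m: "m \<in> gp_supp a" "\<And>x. x \<in> gp_supp a \<Longrightarrow> m \<le> x"
    using well_ordered_least[OF well_ordered_gp_supp order_refl] by blast
  define w where "w = gp_monom (inverse (gp_coeff a m)) (- m)"
  define u where "u = 1 - w * a"
  have coeff_u: "gp_coeff u x = (if x = 0 then 1 else 0) - inverse (gp_coeff a m) * gp_coeff a (x + m)" for x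
    by (simp add: u_def w_def gp_coeff_monom_times gp_coeff_one)
  have u_pos: "0 < x" if "x \<in> gp_supp u" for x
  proof -
    have "x \<noteq> 0" using that m(1) by (auto simp: gp_supp_def coeff_u)
    then have "x + m \<in> gp_supp a" using that by (auto simp: gp_supp_def coeff_u)
    then have "0 \<le> x" using m(2)[of "x + m"] by simp
    then show ?thesis using \<open>x \<noteq> 0\<close> by simp
  qed
  have "\<exists>d>0. \<forall>x\<in>gp_supp u. d \<le> x"
  proof (cases "gp_supp u = {}")
    case True
    then show ?thesis by (auto intro: exI[of _ 1])
  next
    case False
    then obtain d where "d \<in> gp_supp u" "\<And>x. x \<in> gp_supp u \<Longrightarrow> d \<le> x"
      using well_ordered_least[OF well_ordered_gp_supp order_refl] by blast
    then show ?thesis using u_pos by blast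
  qed
  then obtain d where "d > 0" "\<And>x. x \<in> gp_supp u \<Longrightarrow> d \<le> x" by blast
  then obtain v where "(1 - u) * v = 1" using gp_inverse_one_minus[of d u] by blast
  then have "(w * a) * v = 1" by (simp add: u_def)
  then have "a * (w * v) = 1" by (simp only: ac_simps)
  then show ?thesis by blast
qed

instantiation gpuiseux :: (field) field
begin

definition inverse_gpuiseux :: "'a gpuiseux \<Rightarrow> 'a gpuiseux" where
  "inverse_gpuiseux a = (if a = 0 then 0 else (THE b. a * b = 1))"

definition divide_gpuiseux :: "'a gpuiseux \<Rightarrow> 'a gpuiseux \<Rightarrow> 'a gpuiseux" where
  "divide_gpuiseux a b = a * inverse b"

instance
proof
  fix a b :: "'a gpuiseux"
  show "inverse a * a = 1" if nz: "a \<noteq> 0"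
  proof -
    obtain b where b: "a * b = 1" using gp_inverse_exists[OF nz] by blast
    have uniq: "c = b" if "a * c = 1" for c
    proof -
      have "c = (a * b) * c" using b by simp
      also have "\<dots> = b * (a * c)" by (simp only: ac_simps)
      finally show ?thesis using that by simp
    qed
    have "(THE b. a * b = 1) = b" using b uniq by (rule the_equality)
    then show ?thesis using nz b by (simp add: inverse_gpuiseux_def mult.commute)
  qed
  show "a div b = a * inverse b" by (rule divide_gpuiseux_def)
  show "inverse (0 :: 'a gpuiseux) = 0" by (simp add: inverse_gpuiseux_def)
qed

end

definition gp_deg :: "'a::zero gpuiseux \<Rightarrow> ereal" where
  "gp_deg a = (if a = 0 then \<infinity> else ereal (LEAST e. e \<in> gp_supp a))"

lemma gp_deg_zero: "gp_deg 0 = \<infinity>"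
  by (simp add: gp_deg_def)

lemma gp_deg_monom:
  assumes "c \<noteq> 0"
  shows "gp_deg (gp_monom c e) = ereal e"
proof -
  have "gp_supp (gp_monom c e) = {e}" using assms by (auto simp: gp_supp_def gp_coeff_monom)
  moreover have "gp_monom c e \<noteq> 0"
  proof
    assume "gp_monom c e = 0"
    then have "gp_coeff (gp_monom c e) e = 0" by simp
    then show False using assms by (simp add: gp_coeff_monom)
  qed
  moreover have "(LEAST x. x = e) = e" by (rule Least_equality) auto
  ultimately show ?thesis by (simp add: gp_deg_def)
qed

section \<open>Tropical matrices\<close>

text \<open>The tropical semiring is the set of extended reals other than \<open>-\<infinity>\<close>.\<close>

definition tropical_mat :: "nat \<Rightarrow> nat \<Rightarrow> ereal mat set" where
  "tropical_mat m n = {A \<in> carrier_mat m n. \<forall>i<m. \<forall>j<n. A $$ (i, j) \<noteq> -\<infinity>}"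

definition perm_weight :: "ereal mat \<Rightarrow> (nat \<Rightarrow> nat) \<Rightarrow> ereal" where
  "perm_weight B \<sigma> = (\<Sum>p<dim_row B. B $$ (p, \<sigma> p))"

definition tropical_det :: "ereal mat \<Rightarrow> ereal" where
  "tropical_det B = Min (perm_weight B ` {\<sigma>. \<sigma> permutes {..<dim_row B}})"

definition tropically_nonsingular :: "ereal mat \<Rightarrow> bool" where
  "tropically_nonsingular B \<longleftrightarrow> square_mat B \<and> \<bar>tropical_det B\<bar> \<noteq> \<infinity> \<and>
    (\<exists>!\<sigma>. \<sigma> permutes {..<dim_row B} \<and> perm_weight B \<sigma> = tropical_det B)"

text \<open>The empty matrix is non-singular, so a matrix without a finite entry has rank 0.\<close>

definition tropical_rank :: "ereal mat \<Rightarrow> nat" where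
  "tropical_rank A = Max {m. \<exists>I J. I \<subseteq> {..<dim_row A} \<and> J \<subseteq> {..<dim_col A} \<and>
    card I = m \<and> card J = m \<and> tropically_nonsingular (submatrix A I J)}"

text \<open>The first argument only names the coefficient field.\<close>

definition kapranov_rank :: "'f::field itself \<Rightarrow> ereal mat \<Rightarrow> nat" where
  "kapranov_rank F A = (LEAST r. \<exists>L :: 'f gpuiseux mat.
    L \<in> carrier_mat (dim_row A) (dim_col A) \<and>
    (\<forall>i<dim_row A. \<forall>j<dim_col A. gp_deg (L $$ (i, j)) = A $$ (i, j)) \<and>
    vec_space.rank (dim_row A) L = r)"

text \<open>The set under the maximum is finite and nonempty, and the one under the minimum is nonempty.\<close>

lemma tropical_rank_finite:
  "finite {m. \<exists>I J. I \<subseteq> {..<dim_row A} \<and> J \<subseteq> {..<dim_col A} \<and>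
    card I = m \<and> card J = m \<and> tropically_nonsingular (submatrix A I J)}"
proof (rule finite_subset)
  show "{m. \<exists>I J. I \<subseteq> {..<dim_row A} \<and> J \<subseteq> {..<dim_col A} \<and>
      card I = m \<and> card J = m \<and> tropically_nonsingular (submatrix A I J)} \<subseteq> {..dim_row A}"
    using card_mono[of "{..<dim_row A}"] by fastforce
qed simp

lemma tropically_nonsingular_empty: "tropically_nonsingular (submatrix A {} {})"
  by (simp add: tropically_nonsingular_def tropical_det_def perm_weight_def dim_submatrix)

lemma kapranov_lift_exists:
  assumes "A \<in> tropical_mat m n"
  shows "\<exists>L \<in> carrier_mat m n. \<forall>i<m. \<forall>j<n.
    gp_deg (L $$ (i, j) :: 'f::field gpuiseux) = A $$ (i, j)"
proof (intro bexI[of _ "mat m n (\<lambda>p. if A $$ p = \<infinity> then 0 else gp_monom 1 (real_of_ereal (A $$ p)))"]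
    allI impI)
  fix i j assume ij: "i < m" "j < n"
  then have "A $$ (i, j) \<noteq> -\<infinity>" using assms by (simp add: tropical_mat_def)
  then show "gp_deg (mat m n (\<lambda>p. if A $$ p = \<infinity> then 0 else gp_monom 1 (real_of_ereal (A $$ p)))
      $$ (i, j) :: 'f gpuiseux) = A $$ (i, j)"
    using ij by (cases "A $$ (i, j)") (simp_all add: gp_deg_monom gp_deg_zero)
qed simp

end

theory Submission
  imports Defs "HOL-Analysis.Continuum_Not_Denumerable"
begin

text \<open>The matrix is \<open>0\<close> on a set \<open>Z\<close> of at most \<open>\<alpha>\<^sup>2 n\<^sup>2\<close> positions, and its other
  entries are real numbers in \<open>(1, 2)\<close> that are linearly independent over the rationals.

  If \<open>Z\<close> meets every \<open>c \<times> c\<close> rectangle, then the tropical rank is less than \<open>3 c\<close>.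
  A greedy hitting set argument yields such a \<open>Z\<close> with \<open>c\<close> about \<open>4 ln n / \<alpha>\<^sup>2\<close>.

  In a lift of rank \<open>r\<close>, all entries are polynomials of degree at most 2 in
  \<open>n\<^sup>2 - (n - r)\<^sup>2\<close> elements, while the entries outside \<open>Z\<close> are algebraically independent over
  the coefficient field because distinct monomials in them have distinct degrees. Comparing the
  number of monomials with the dimension of their span gives \<open>n\<^sup>2 - |Z| \<le> n\<^sup>2 - (n - r)\<^sup>2\<close>,
  hence \<open>n - r \<le> \<alpha> n\<close>.\<close>

section \<open>Degrees and linear independence\<close>

text \<open>Only finite degrees are captured: \<open>has_deg 0 d\<close> never holds. Stated by
  coefficients, it avoids \<open>LEAST\<close> when products are computed.\<close>

definition has_deg :: "'a::zero gpuiseux \<Rightarrow> real \<Rightarrow> bool" where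
  "has_deg a d \<longleftrightarrow> gp_coeff a d \<noteq> 0 \<and> (\<forall>x<d. gp_coeff a x = 0)"

lemma has_deg_if_gp_deg:
  assumes "gp_deg a = ereal d"
  shows "has_deg a d"
proof -
  have "a \<noteq> 0" using assms by (auto simp: gp_deg_def)
  then have "gp_supp a \<noteq> {}" using gp_eqI[of a 0] by (auto simp: gp_supp_def)
  then obtain m where m: "m \<in> gp_supp a" "\<And>x. x \<in> gp_supp a \<Longrightarrow> m \<le> x"
    using well_ordered_least[OF well_ordered_gp_supp order_refl] by blast
  have "(LEAST e. e \<in> gp_supp a) = m" using m by (rule Least_equality)
  then have "d = m" using assms \<open>a \<noteq> 0\<close> by (simp add: gp_deg_def)
  then show ?thesis using m by (force simp: has_deg_def gp_supp_def)
qed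

lemma has_deg_one: "has_deg (1 :: 'a::comm_ring_1 gpuiseux) 0"
  by (simp add: has_deg_def gp_coeff_one)

text \<open>In the convolution at \<open>d + e\<close> only the pair of leading coefficients
  survives, and its product is nonzero in a field.\<close>

lemma has_deg_mult:
  fixes a b :: "'a::field gpuiseux"
  assumes "has_deg a d" "has_deg b e"
  shows "has_deg (a * b) (d + e)"
proof -
  have ge: "d \<le> x" if "gp_coeff a x \<noteq> 0" for x
    using assms(1) that by (meson has_deg_def not_le)
  have ge': "e \<le> x" if "gp_coeff b x \<noteq> 0" for x
    using assms(2) that by (meson has_deg_def not_le)
  have low: "{x. gp_coeff a x \<noteq> 0 \<and> gp_coeff b (z - x) \<noteq> 0} = {}" if "z < d + e" for z
    using ge ge' that by force
  have "{x. gp_coeff a x \<noteq> 0 \<and> gp_coeff b (d + e - x) \<noteq> 0} = {d}"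
    using ge ge' assms by (force simp: has_deg_def)
  then have "gp_coeff (a * b) (d + e) = gp_coeff a d * gp_coeff b e"
    unfolding gp_coeff_times gp_conv_def by simp
  then show ?thesis
    using assms low by (simp add: has_deg_def gp_coeff_times gp_conv_def del: Collect_empty_eq)
qed

lemma has_deg_power: "has_deg (a :: 'a::field gpuiseux) d \<Longrightarrow> has_deg (a ^ k) (real k * d)"
  by (induction k) (auto simp: has_deg_one algebra_simps dest: has_deg_mult)

lemma has_deg_prod:
  assumes "\<And>t. t \<in> T \<Longrightarrow> has_deg (a t :: 'a::field gpuiseux) (d t)"
  shows "has_deg (\<Prod>t\<in>T. a t) (\<Sum>t\<in>T. d t)"
  using assms by (induction T rule: infinite_finite_induct) (auto simp: has_deg_one has_deg_mult)

lemma has_deg_unique: "has_deg a d \<Longrightarrow> has_deg a e \<Longrightarrow> d = e"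
  unfolding has_deg_def by (meson linorder_neqE_linordered_idom)

text \<open>Scalars are coefficients, embedded as constant series. The dimensions compared below are
  over the coefficient field, not over the field of series.\<close>

interpretation gp: vector_space "\<lambda>(c::'a::field) (x::'a gpuiseux). gp_monom c 0 * x"
proof
  fix a b :: 'a and x y :: "'a gpuiseux"
  show "gp_monom a 0 * (x + y) = gp_monom a 0 * x + gp_monom a 0 * y" by (simp add: distrib_left)
  show "gp_monom (a + b) 0 * x = gp_monom a 0 * x + gp_monom b 0 * x"
    by (rule gp_eqI) (simp add: gp_coeff_monom_times distrib_right)
  show "gp_monom a 0 * (gp_monom b 0 * x) = gp_monom (a * b) 0 * x"
    by (rule gp_eqI) (simp add: gp_coeff_monom_times)
  show "gp_monom 1 0 * x = x"
    by (rule gp_eqI) (simp add: gp_coeff_monom_times)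
qed

text \<open>Among the terms of a relation with nonzero scalar, the one of least degree is unique, so
  nothing cancels its leading coefficient.\<close>

lemma independent_distinct_degs:
  assumes deg: "\<And>x. x \<in> S \<Longrightarrow> has_deg x (d x)" and inj: "inj_on d S"
  shows "gp.independent S"
proof
  assume "gp.dependent S"
  then obtain t u where t: "finite t" "t \<subseteq> S" "(\<Sum>v\<in>t. gp_monom (u v) 0 * v) = 0"
    and "\<exists>v\<in>t. u v \<noteq> 0" unfolding gp.dependent_explicit by blast
  then have ne: "finite {v\<in>t. u v \<noteq> 0}" "{v\<in>t. u v \<noteq> 0} \<noteq> {}" by auto
  define w where "w = arg_min_on d {v\<in>t. u v \<noteq> 0}"
  have w: "w \<in> t" "u w \<noteq> 0" using arg_min_if_finite(1)[OF ne, of d] by (auto simp: w_def)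
  have wmin: "d w \<le> d v" if "v \<in> t" "u v \<noteq> 0" for v
    unfolding w_def using arg_min_least[OF ne] that by blast
  have "0 = gp_coeff (\<Sum>v\<in>t. gp_monom (u v) 0 * v) (d w)" using t by simp
  also have "\<dots> = (\<Sum>v\<in>t. u v * gp_coeff v (d w))" by (simp add: gp_coeff_sum gp_coeff_monom_times)
  also have "\<dots> = (\<Sum>v\<in>{w}. u v * gp_coeff v (d w))"
  proof (rule sum.mono_neutral_right)
    show "\<forall>v\<in>t - {w}. u v * gp_coeff v (d w) = 0"
    proof
      fix v assume v: "v \<in> t - {w}"
      show "u v * gp_coeff v (d w) = 0"
      proof (cases "u v = 0")
        case False
        have "d w \<noteq> d v" using inj_onD[OF inj, of w v] v w(1) t(2) by blast
        then have "d w < d v" using wmin[of v] v False by simp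
        then show ?thesis using deg[of v] v t by (auto simp: has_deg_def)
      qed simp
    qed
  qed (use t w in auto)
  also have "\<dots> \<noteq> 0" using w t deg[of w] by (auto simp: has_deg_def)
  finally show False by simp
qed

section \<open>Spans of monomials with bounded exponents\<close>

text \<open>The bound is on each exponent, not on the total degree, so that for finite
  \<open>I\<close> the exponent vectors form a box with \<open>(k + 1) ^ card I\<close>
  points.\<close>

definition gp_poly_span :: "'i set \<Rightarrow> ('i \<Rightarrow> 'a::field gpuiseux) \<Rightarrow> nat \<Rightarrow> 'a gpuiseux set" where
  "gp_poly_span I y k = gp.span ((\<lambda>h. \<Prod>i\<in>I. y i ^ h i) ` {h. \<forall>i\<in>I. h i \<le> k})"

text \<open>Exponents add on monomials (\<open>mm\<close>); linearity extends this to the second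
  factor (\<open>mb\<close>) and then to the first.\<close>

lemma gp_poly_span_mult:
  assumes "a \<in> gp_poly_span I y j" "b \<in> gp_poly_span I y k"
  shows "a * b \<in> gp_poly_span I y (j + k)"
proof -
  let ?m = "\<lambda>h. \<Prod>i\<in>I. y i ^ h i"
  have mm: "?m g * ?m h \<in> gp_poly_span I y (j + k)"
    if "\<forall>i\<in>I. g i \<le> j" "\<forall>i\<in>I. h i \<le> k" for g h
  proof -
    have "?m g * ?m h = ?m (\<lambda>i. g i + h i)" by (simp add: power_add prod.distrib)
    then show ?thesis unfolding gp_poly_span_def using that
      by (auto intro!: gp.span_base image_eqI[of _ _ "\<lambda>i. g i + h i"] add_mono)
  qed
  have mb: "?m g * b \<in> gp_poly_span I y (j + k)" if g: "\<forall>i\<in>I. g i \<le> j" for g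
    using assms(2) unfolding gp_poly_span_def[of I y k]
  proof (induction rule: gp.span_induct_alt)
    case base
    then show ?case by (simp add: gp_poly_span_def gp.span_zero)
  next
    case (step c x z)
    have "?m g * (gp_monom c 0 * x + z) = gp_monom c 0 * (?m g * x) + ?m g * z"
      by (simp add: algebra_simps)
    moreover have "?m g * x \<in> gp_poly_span I y (j + k)" using step mm[OF g] by auto
    ultimately show ?case using step unfolding gp_poly_span_def
      by (simp only:) (intro gp.span_add gp.span_scale)
  qed
  show ?thesis
    using assms(1) unfolding gp_poly_span_def[of I y j]
  proof (induction rule: gp.span_induct_alt)
    case base
    then show ?case by (simp add: gp_poly_span_def gp.span_zero)
  next
    case (step c x z)
    have "(gp_monom c 0 * x + z) * b = gp_monom c 0 * (x * b) + z * b"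
      by (simp add: algebra_simps)
    moreover have "x * b \<in> gp_poly_span I y (j + k)" using step mb by auto
    ultimately show ?case using step unfolding gp_poly_span_def
      by (simp only:) (intro gp.span_add gp.span_scale)
  qed
qed

lemma gp_poly_span_mono: "j \<le> k \<Longrightarrow> gp_poly_span I y j \<subseteq> gp_poly_span I y k"
  unfolding gp_poly_span_def by (intro gp.span_mono image_mono) (auto intro: order_trans)

lemma gp_poly_span_one: "1 \<in> gp_poly_span I y k"
  unfolding gp_poly_span_def by (intro gp.span_base image_eqI[of _ _ "\<lambda>_. 0"]) auto

lemma gp_poly_span_var:
  assumes "finite I" "i \<in> I"
  shows "y i \<in> gp_poly_span I y 1"
  unfolding gp_poly_span_def
  using assms by (intro gp.span_base image_eqI[of _ _ "\<lambda>j. if j = i then 1 else 0"])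
    (auto simp: if_distrib[of "\<lambda>k. _ ^ k"] prod.delta cong: if_cong)

lemma gp_poly_span_sum:
  "(\<And>s. s \<in> S \<Longrightarrow> f s \<in> gp_poly_span I y k) \<Longrightarrow> sum f S \<in> gp_poly_span I y k"
  unfolding gp_poly_span_def by (rule gp.span_sum)

lemma gp_poly_span_power:
  assumes "a \<in> gp_poly_span I y j"
  shows "a ^ k \<in> gp_poly_span I y (k * j)"
  using gp_poly_span_mult[OF assms] by (induction k) (auto simp: gp_poly_span_one)

lemma gp_poly_span_prod:
  assumes "\<And>t. t \<in> T \<Longrightarrow> a t \<in> gp_poly_span I y j"
  shows "(\<Prod>t\<in>T. a t) \<in> gp_poly_span I y (card T * j)"
  using assms gp_poly_span_mult
  by (induction T rule: infinite_finite_induct) (fastforce simp: gp_poly_span_one)+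

text \<open>A transcendence degree bound by counting. The \<open>D ^ card T\<close> monomials in the
  \<open>x t\<close> with exponents below \<open>D\<close> have distinct degrees, hence are
  independent, yet lie in a span of at most \<open>(card T * (D * b) + 1) ^ card I\<close> monomials
  in the \<open>y i\<close>. For large \<open>D\<close> this forces
  \<open>card T \<le> card I\<close>.\<close>

lemma card_le_if_degs_independent:
  fixes x :: "'t \<Rightarrow> 'a::field gpuiseux"
  assumes fin: "finite T" "finite I"
    and x: "\<And>t. t \<in> T \<Longrightarrow> x t \<in> gp_poly_span I y b"
    and deg: "\<And>t. t \<in> T \<Longrightarrow> has_deg (x t) (g t)"
    and inj: "\<And>e e' :: 't \<Rightarrow> nat. (\<Sum>t\<in>T. real (e t) * g t) = (\<Sum>t\<in>T. real (e' t) * g t) \<Longrightarrow>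
      (\<forall>t\<in>T. e t = e' t)"
  shows "card T \<le> card I"
proof (rule ccontr)
  assume less: "\<not> card T \<le> card I"
  define m N where "m = card T" and "N = card I"
  have key: "D ^ m \<le> (m * (D * b) + 1) ^ N" for D
  proof -
    let ?E = "PiE T (\<lambda>_. {..<D})" and ?x = "\<lambda>e. \<Prod>t\<in>T. x t ^ e t"
    let ?H = "PiE I (\<lambda>_. {..m * (D * b)})" and ?y = "\<lambda>h. \<Prod>i\<in>I. y i ^ h i"
    let ?d = "\<lambda>e. \<Sum>t\<in>T. real (e t) * g t"
    have dx: "has_deg (?x e) (?d e)" for e
      by (intro has_deg_prod has_deg_power deg)
    have injE: "e = e'" if "e \<in> ?E" "e' \<in> ?E" "?d e = ?d e'" for e e'
      using inj[OF that(3)] that(1,2) by (auto intro: PiE_ext)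
    have injx: "inj_on ?x ?E"
      using dx has_deg_unique injE by (metis (mono_tags, lifting) inj_onI)
    \<comment> \<open>The degree must be a function of the series, so the exponents are recovered
      from the monomial; \<open>injx\<close> makes this unambiguous.\<close>
    define d where "d z = ?d (inv_into ?E ?x z)" for z
    have "gp.independent (?x ` ?E)"
    proof (rule independent_distinct_degs)
      show "has_deg z (d z)" if "z \<in> ?x ` ?E" for z
        using dx[of "inv_into ?E ?x z"] f_inv_into_f[OF that] by (simp add: d_def)
      show "inj_on d (?x ` ?E)"
      proof (rule inj_onI, elim imageE)
        fix z z' e e'
        assume h: "d z = d z'" "z = ?x e" "e \<in> ?E" "z' = ?x e'" "e' \<in> ?E"
        then have "?d e = ?d e'" by (simp add: d_def inv_into_f_f[OF injx])
        then show "z = z'" using injE[of e e'] h by simp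
      qed
    qed
    moreover have "?x ` ?E \<subseteq> gp.span (?y ` ?H)"
    proof (rule image_subsetI)
      fix e assume e: "e \<in> ?E"
      have "x t ^ e t \<in> gp_poly_span I y (D * b)" if "t \<in> T" for t
      proof -
        have "e t * b \<le> D * b" using e that by (auto simp: PiE_iff intro!: mult_right_mono less_imp_le)
        then show ?thesis using gp_poly_span_power[OF x[OF that], of "e t"] gp_poly_span_mono by blast
      qed
      then have "?x e \<in> gp_poly_span I y (m * (D * b))" unfolding m_def by (rule gp_poly_span_prod)
      \<comment> \<open>Exponents outside \<open>I\<close> do not affect the monomial and are reset
        to fit the finite box \<open>?H\<close>.\<close>
      moreover have "?y ` {h. \<forall>i\<in>I. h i \<le> m * (D * b)} \<subseteq> ?y ` ?H"
      proof (rule image_subsetI)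
        fix h assume "h \<in> {h. \<forall>i\<in>I. h i \<le> m * (D * b)}"
        then show "?y h \<in> ?y ` ?H"
          by (intro image_eqI[of _ _ "restrict h I"]) auto
      qed
      ultimately show "?x e \<in> gp.span (?y ` ?H)"
        unfolding gp_poly_span_def using gp.span_mono by blast
    qed
    ultimately have "card (?x ` ?E) \<le> card (?y ` ?H)"
      using gp.independent_span_bound[of "?y ` ?H" "?x ` ?E"] fin by (simp add: finite_PiE)
    also have "\<dots> \<le> card ?H" using fin by (intro card_image_le finite_PiE) auto
    finally show ?thesis
      using fin by (simp add: card_image[OF injx] card_PiE m_def N_def)
  qed
  \<comment> \<open>If \<open>card T\<close> exceeded \<open>card I\<close>, \<open>key\<close>
    would give \<open>D * D ^ N \<le> (m * b + 1) ^ N * D ^ N\<close>; this \<open>D\<close> is one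
    too large for that.\<close>
  define D where "D = (m * b + 1) ^ N + 1"
  have "D * D ^ N \<le> D ^ m"
    using less power_increasing[of "Suc N" m D] by (simp add: m_def N_def D_def)
  also have "\<dots> \<le> (m * (D * b) + 1) ^ N" by (rule key)
  also have "\<dots> \<le> ((m * b + 1) * D) ^ N"
    by (intro power_mono) (auto simp: algebra_simps D_def)
  also have "\<dots> = (m * b + 1) ^ N * D ^ N" by (rule power_mult_distrib)
  finally show False by (simp add: D_def)
qed

section \<open>Real degrees in general position\<close>

text \<open>Values are chosen one at a time: two equal sums with different exponents at the new
  index determine the new value, and only countably many values arise so, while the interval is
  uncountable. Natural exponents on both sides express independence over the rationals.\<close>

lemma generic_reals_exist:
  fixes a b :: real
  assumes "finite T" "a < b"
  shows "\<exists>g. (\<forall>t\<in>T. a < g t \<and> g t < b) \<and> (\<forall>e e' :: 't \<Rightarrow> nat.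
    (\<Sum>t\<in>T. real (e t) * g t) = (\<Sum>t\<in>T. real (e' t) * g t) \<longrightarrow> (\<forall>t\<in>T. e t = e' t))"
  using assms(1)
proof (induction T rule: finite_induct)
  case empty
  then show ?case by simp
next
  case (insert s T)
  then obtain g where g: "\<forall>t\<in>T. a < g t \<and> g t < b"
    "\<And>e e' :: 't \<Rightarrow> nat. (\<Sum>t\<in>T. real (e t) * g t) = (\<Sum>t\<in>T. real (e' t) * g t) \<Longrightarrow> \<forall>t\<in>T. e t = e' t"
    by blast
  define W where "W = (\<lambda>e. \<Sum>t\<in>T. real (e t) * g t) ` PiE T (\<lambda>_. UNIV :: nat set)"
  \<comment> \<open>For \<open>k = l\<close> the quotient is 0 by convention, which leaves the set
    countable.\<close>
  define bad where "bad = (\<lambda>(u, v, k :: nat, l :: nat). (u - v) / (real k - real l)) ` (W \<times> W \<times> UNIV \<times> UNIV)"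
  have "countable W" unfolding W_def using insert.hyps by (intro countable_image) (induction T rule: finite_induct; auto simp: PiE_insert_eq)
  then have "countable bad" unfolding bad_def by (intro countable_image countable_SIGMA) auto
  then have "\<not> {a<..<b} \<subseteq> bad"
    using uncountable_open_interval[of a b] assms(2) countable_subset by blast
  then obtain z where z: "a < z" "z < b" "z \<notin> bad" by (meson greaterThanLessThan_iff subsetI)
  define g' where "g' = g(s := z)"
  have eq: "(\<Sum>t\<in>insert s T. real (e t) * g' t) = real (e s) * z + (\<Sum>t\<in>T. real (e t) * g t)" for e
    using insert.hyps by (simp add: g'_def) (intro sum.cong; auto)
  have W: "(\<Sum>t\<in>T. real (e t) * g t) \<in> W" for e
    unfolding W_def by (intro image_eqI[of _ _ "restrict e T"]) auto
  have "\<forall>t\<in>insert s T. e t = e' t"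
    if h: "(\<Sum>t\<in>insert s T. real (e t) * g' t) = (\<Sum>t\<in>insert s T. real (e' t) * g' t)"
    for e e' :: "'t \<Rightarrow> nat"
  proof -
    let ?u = "\<Sum>t\<in>T. real (e t) * g t" and ?v = "\<Sum>t\<in>T. real (e' t) * g t"
    have h': "real (e s) * z + ?u = real (e' s) * z + ?v" using h unfolding eq .
    have "e s = e' s"
    proof (rule ccontr)
      assume "e s \<noteq> e' s"
      then have "z = (?v - ?u) / (real (e s) - real (e' s))"
        using h' by (simp add: field_simps)
      then have "z \<in> bad" unfolding bad_def using W
        by (intro image_eqI[of _ _ "(?v, ?u, e s, e' s)"]) auto
      then show False using z by simp
    qed
    moreover have "?u = ?v" using h' \<open>e s = e' s\<close> by simp
    ultimately show ?thesis using g(2)[of e e'] by blast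
  qed
  moreover have "\<forall>t\<in>insert s T. a < g' t \<and> g' t < b" using g(1) z by (auto simp: g'_def)
  ultimately show ?case by blast
qed

section \<open>Kapranov rank of generic matrices\<close>

text \<open>A rank factorization: a maximal independent set of columns spans all columns.\<close>

lemma (in vec_space) rank_column_basis:
  assumes A: "A \<in> carrier_mat n nc"
  shows "\<exists>C X. C \<subseteq> {..<nc} \<and> card C = rank A \<and>
    (\<forall>i<n. \<forall>j<nc. A $$ (i, j) = (\<Sum>c\<in>C. X c j * A $$ (i, c)))"
proof -
  have cols: "set (cols A) = col A ` {..<nc}" using A by (auto simp: cols_def)
  have carr: "set (cols A) \<subseteq> carrier_vec n" using A cols_dim by blast
  have "lin_indpt {}" by (simp add: lin_dep_def)
  then obtain S where "finite S" and max: "maximal S (\<lambda>T. T \<subseteq> set (cols A) \<and> lin_indpt T)"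
    using maximal_exists_superset[of "set (cols A)" "\<lambda>T. T \<subseteq> set (cols A) \<and> lin_indpt T" "{}"]
    by auto
  then have S: "S \<subseteq> set (cols A)" "lin_indpt S" by (auto simp: maximal_def)
  have Sc: "S \<subseteq> carrier_vec n" using S carr by blast
  \<comment> \<open>Equal columns are one element of \<open>S\<close>, so one index is picked for
    each, to make \<open>card C\<close> the rank.\<close>
  obtain C where C: "C \<subseteq> {..<nc}" "inj_on (col A) C" "S = col A ` C"
    using S(1) unfolding cols by (meson subset_image_inj)
  have "rank A = card C"
    using rank_card_indpt[OF A max] C by (simp add: card_image)
  have "\<exists>a. \<forall>i<n. A $$ (i, j) = (\<Sum>c\<in>C. a c * A $$ (i, c))" if j: "j < nc" for j
  proof -
    have cj: "col A j \<in> set (cols A)" using j cols by blast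
    have "col A j \<in> span S"
    proof (cases "col A j \<in> S")
      case True
      then show ?thesis using span_mem Sc by auto
    next
      case False
      then have "\<not> lin_indpt (S \<union> {col A j})"
        using max S cj unfolding maximal_def by blast
      then show ?thesis
        using lin_dep_iff_in_span[of S "col A j"] Sc S(2) False cj carr by auto
    qed
    then obtain a where a: "lincomb a S = col A j"
      using finite_in_span[OF \<open>finite S\<close>, of "col A j"] Sc by auto
    have "A $$ (i, j) = (\<Sum>c\<in>C. a (col A c) * A $$ (i, c))" if "i < n" for i
    proof -
      have "A $$ (i, j) = lincomb a S $ i" using a A that j by simp
      also have "\<dots> = (\<Sum>x\<in>S. a x * x $ i)" by (rule lincomb_index[OF that Sc])
      also have "\<dots> = (\<Sum>c\<in>C. a (col A c) * col A c $ i)" using C by (simp add: sum.reindex)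
      also have "\<dots> = (\<Sum>c\<in>C. a (col A c) * A $$ (i, c))"
        using A C that by (intro sum.cong) (auto simp: subset_iff)
      finally show ?thesis .
    qed
    then show ?thesis by (intro exI[of _ "\<lambda>c. a (col A c)"]) simp
  qed
  then have "\<forall>j. \<exists>a. j < nc \<longrightarrow> (\<forall>i<n. A $$ (i, j) = (\<Sum>c\<in>C. a c * A $$ (i, c)))" by blast
  then obtain X where "\<forall>j. j < nc \<longrightarrow> (\<forall>i<n. A $$ (i, j) = (\<Sum>c\<in>C. X j c * A $$ (i, c)))"
    by metis
  then show ?thesis using C(1) \<open>rank A = card C\<close>
    by (intro exI[of _ C] exI[of _ "\<lambda>c j. X j c"]) auto
qed

text \<open>A factorization of rank \<open>r\<close> expresses all entries through
  \<open>n * r\<close> basis entries and \<open>r * (n - r)\<close> coefficients, and by the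
  counting bound the entries on \<open>T\<close> cannot outnumber these.\<close>

lemma rank_lower_bound_generic_degs:
  fixes L :: "'a::field gpuiseux mat"
  assumes L: "L \<in> carrier_mat n n" and T: "T \<subseteq> {..<n} \<times> {..<n}"
    and deg: "\<And>t. t \<in> T \<Longrightarrow> gp_deg (L $$ t) = ereal (g t)"
    and inj: "\<And>e e' :: nat \<times> nat \<Rightarrow> nat.
      (\<Sum>t\<in>T. real (e t) * g t) = (\<Sum>t\<in>T. real (e' t) * g t) \<Longrightarrow> \<forall>t\<in>T. e t = e' t"
  shows "card T + (n - vec_space.rank n L)\<^sup>2 \<le> n\<^sup>2"
proof -
  define r where "r = vec_space.rank n L"
  obtain C X where C: "C \<subseteq> {..<n}" "card C = r"
    and X: "\<And>i j. i < n \<Longrightarrow> j < n \<Longrightarrow> L $$ (i, j) = (\<Sum>c\<in>C. X c j * L $$ (i, c))"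
    using vec_space.rank_column_basis[OF L] unfolding r_def by blast
  have fC: "finite C" using C finite_subset by blast
  have rn: "r \<le> n" using C card_mono[of "{..<n}" C] by simp
  \<comment> \<open>Left: entries in the basis columns. Right: coefficients of the other columns;
    leaving out those of the basis columns saves \<open>r * r\<close> variables.\<close>
  define I :: "(nat \<times> nat + nat \<times> nat) set" where "I = ({..<n} \<times> C) <+> (C \<times> ({..<n} - C))"
  define y where "y = case_sum (\<lambda>t. L $$ t) (\<lambda>(c, j). X c j)"
  have fI: "finite I" using fC by (simp add: I_def)
  have var: "y i \<in> gp_poly_span I y 1" if "i \<in> I" for i
    using gp_poly_span_var[OF fI that] .
  have entry: "L $$ (i, j) \<in> gp_poly_span I y 2" if ij: "i < n" "j < n" for i j
  proof (cases "j \<in> C")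
    case True
    then have "L $$ (i, j) \<in> gp_poly_span I y 1"
      using var[of "Inl (i, j)"] ij by (auto simp: I_def y_def)
    then show ?thesis using gp_poly_span_mono[of 1 2 I y] by auto
  next
    case False
    have "X c j * L $$ (i, c) \<in> gp_poly_span I y (1 + 1)" if "c \<in> C" for c
      using var[of "Inl (i, c)"] var[of "Inr (c, j)"] ij that False
      by (intro gp_poly_span_mult) (auto simp: I_def y_def)
    then show ?thesis unfolding X[OF ij] by (intro gp_poly_span_sum) (simp add: numeral_2_eq_2)
  qed
  have "card T \<le> card I"
  proof (rule card_le_if_degs_independent)
    show "finite T" using T finite_subset by blast
    show "L $$ t \<in> gp_poly_span I y 2" if "t \<in> T" for t using entry that T by auto
    show "has_deg (L $$ t) (g t)" if "t \<in> T" for t using deg[OF that] by (rule has_deg_if_gp_deg)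
  qed (use fI inj in auto)
  also have "card I = n * r + r * (n - r)"
    using C fC by (simp add: I_def card_Plus card_Diff_subset)
  finally have "card T \<le> n * r + r * (n - r)" .
  moreover have "n * r + r * (n - r) + (n - r)\<^sup>2 = n\<^sup>2"
    using rn by (auto simp: le_iff_add power2_eq_square algebra_simps)
  ultimately show ?thesis unfolding r_def by linarith
qed

text \<open>Some lift exists, so the least rank is attained, and the previous bound applies to a
  lift attaining it.\<close>

lemma kapranov_rank_lower_bound:
  assumes A: "A \<in> tropical_mat n n" and T: "T \<subseteq> {..<n} \<times> {..<n}"
    and deg: "\<And>t. t \<in> T \<Longrightarrow> A $$ t = ereal (g t)"
    and inj: "\<And>e e' :: nat \<times> nat \<Rightarrow> nat.
      (\<Sum>t\<in>T. real (e t) * g t) = (\<Sum>t\<in>T. real (e' t) * g t) \<Longrightarrow> \<forall>t\<in>T. e t = e' t"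
  shows "card T + (n - kapranov_rank TYPE('f::field) A)\<^sup>2 \<le> n\<^sup>2"
proof -
  have dim: "dim_row A = n" "dim_col A = n" using A by (auto simp: tropical_mat_def)
  let ?P = "\<lambda>r. \<exists>L :: 'f gpuiseux mat. L \<in> carrier_mat (dim_row A) (dim_col A) \<and>
    (\<forall>i<dim_row A. \<forall>j<dim_col A. gp_deg (L $$ (i, j)) = A $$ (i, j)) \<and>
    vec_space.rank (dim_row A) L = r"
  have "\<exists>r. ?P r" using kapranov_lift_exists[OF A] unfolding dim by blast
  then have "?P (kapranov_rank TYPE('f) A)" unfolding kapranov_rank_def by (rule LeastI_ex)
  then obtain L :: "'f gpuiseux mat" where L: "L \<in> carrier_mat n n"
    "\<And>i j. i < n \<Longrightarrow> j < n \<Longrightarrow> gp_deg (L $$ (i, j)) = A $$ (i, j)"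
    "vec_space.rank n L = kapranov_rank TYPE('f) A" unfolding dim by blast
  have "gp_deg (L $$ t) = ereal (g t)" if "t \<in> T" for t
    using L(2) T deg[OF that] that by (cases t) auto
  from rank_lower_bound_generic_degs[OF L(1) T this inj] show ?thesis unfolding L(3) by simp
qed

section \<open>Tropical rank\<close>

text \<open>A smallest nonempty subset mapped into itself is mapped onto itself, since its image is
  again such a subset. This plays the part of finding a cycle in a digraph without sinks.\<close>

lemma permutation_on_subset_of_self_map:
  assumes "finite Q" "Q \<noteq> {}" "f ` Q \<subseteq> Q"
  shows "\<exists>R\<subseteq>Q. R \<noteq> {} \<and> bij_betw f R R"
proof -
  let ?P = "\<lambda>R. R \<subseteq> Q \<and> R \<noteq> {} \<and> f ` R \<subseteq> R"
  have "?P Q" using assms by blast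
  then obtain R where R: "?P R" and min: "\<And>R'. ?P R' \<Longrightarrow> card R \<le> card R'"
    using ex_has_least_nat[of ?P Q card] by blast
  have fR: "finite R" using R assms(1) finite_subset by blast
  have "card R \<le> card (f ` R)" using R by (intro min) blast
  then have "f ` R = R" using R card_seteq[OF fR] by blast
  then show ?thesis using R eq_card_imp_inj_on[OF fR, of f] by (auto simp: bij_betw_def)
qed

text \<open>Vertices are taken in reverse topological order: adding to \<open>S\<close> a vertex
  without successors among the others outside \<open>S\<close> keeps \<open>S\<close> closed. Loops
  are exempt, as every vertex has one in the application.\<close>

lemma closed_subset_of_card:
  assumes "finite P" "c \<le> card P"
    and sink: "\<And>Q. Q \<subseteq> P \<Longrightarrow> Q \<noteq> {} \<Longrightarrow> \<exists>v\<in>Q. \<forall>w\<in>Q - {v}. \<not> E v w"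
  shows "\<exists>S\<subseteq>P. card S = c \<and> (\<forall>v\<in>S. \<forall>w\<in>P - S. \<not> E v w)"
  using assms(2)
proof (induction c)
  case 0
  then show ?case by (intro exI[of _ "{}"]) auto
next
  case (Suc c)
  then obtain S where S: "S \<subseteq> P" "card S = c" "\<forall>v\<in>S. \<forall>w\<in>P - S. \<not> E v w" by auto
  have fS: "finite S" using S assms(1) finite_subset by blast
  have "P - S \<noteq> {}" using Suc.prems S(2) card_mono[OF fS, of P] by auto
  then obtain v where v: "v \<in> P - S" "\<forall>w\<in>P - S - {v}. \<not> E v w" using sink[of "P - S"] by auto
  show ?case
    using S v fS by (intro exI[of _ "insert v S"]) auto
qed

text \<open>Rows where the optimal permutation misses \<open>Z\<close> are few, because otherwise a swap through \<open>Z\<close>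
  lowers the weight; the remaining rows carry an acyclic digraph, whose successor-closed subsets
  are rectangles missing \<open>Z\<close>.\<close>

lemma unique_optimum_card_less:
  fixes b :: "nat \<Rightarrow> nat \<Rightarrow> real"
  assumes zero: "\<And>p q. p < k \<Longrightarrow> q < k \<Longrightarrow> z p q \<Longrightarrow> b p q = 0"
    and pos: "\<And>p q. p < k \<Longrightarrow> q < k \<Longrightarrow> \<not> z p q \<Longrightarrow> 1 < b p q \<and> b p q < 2"
    and hit: "\<And>I J. I \<subseteq> {..<k} \<Longrightarrow> J \<subseteq> {..<k} \<Longrightarrow> card I = c \<Longrightarrow> card J = c \<Longrightarrow> \<exists>p\<in>I. \<exists>q\<in>J. z p q"
    and perm: "\<sigma> permutes {..<k}"
    and opt: "\<And>\<tau>. \<tau> permutes {..<k} \<Longrightarrow> \<tau> \<noteq> \<sigma> \<Longrightarrow> (\<Sum>p<k. b p (\<sigma> p)) < (\<Sum>p<k. b p (\<tau> p))"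
  shows "k < 3 * c"
proof (rule ccontr)
  assume k: "\<not> k < 3 * c"
  define P where "P = {p. p < k \<and> z p (\<sigma> p)}"
  define R where "R = {p. p < k \<and> \<not> z p (\<sigma> p)}"
  have fin: "finite P" "finite R" by (auto simp: P_def R_def)
  have split: "{..<k} = P \<union> R" "P \<inter> R = {}" by (auto simp: P_def R_def)
  have \<sigma>k: "\<sigma> p < k" if "p < k" for p using perm that by (meson lessThan_iff permutes_in_image)
  have inj\<sigma>: "inj \<sigma>" using perm by (rule permutes_inj)
  \<comment> \<open>Relabelling the columns by \<open>\<sigma>\<close> puts the optimal permutation
    on the diagonal.\<close>
  have hit\<sigma>: "\<exists>p\<in>I. \<exists>q\<in>J. z p (\<sigma> q)" if "I \<subseteq> {..<k}" "J \<subseteq> {..<k}" "card I = c" "card J = c" for I J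
  proof -
    have "\<sigma> ` J \<subseteq> {..<k}" "card (\<sigma> ` J) = c"
      using that \<sigma>k card_image[OF inj_on_subset[OF inj\<sigma>], of J] by auto
    then show ?thesis using hit[of I "\<sigma> ` J"] that by blast
  qed
  have "card R < c"
  proof (rule ccontr)
    assume "\<not> card R < c"
    then obtain R' where R': "R' \<subseteq> R" "card R' = c" by (meson not_less obtain_subset_with_card_n)
    then obtain p q where pq: "p \<in> R" "q \<in> R" "z p (\<sigma> q)" using hit\<sigma>[of R' R'] split by blast
    then have ne: "p \<noteq> q" by (auto simp: R_def)
    have pqk: "p < k" "q < k" using pq by (auto simp: R_def)
    \<comment> \<open>Exchanging the images of \<open>p\<close> and \<open>q\<close> replaces two
      entries above 1 by a zero and an entry below 2, which contradicts optimality.\<close>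
    define \<tau> where "\<tau> = \<sigma> \<circ> transpose p q"
    have "\<tau> permutes {..<k}"
      unfolding \<tau>_def using pqk perm by (intro permutes_compose permutes_swap_id) auto
    moreover have "\<tau> \<noteq> \<sigma>"
    proof
      assume "\<tau> = \<sigma>"
      then have "\<tau> p = \<sigma> p" by simp
      then show False using ne injD[OF inj\<sigma>, of q p] by (simp add: \<tau>_def)
    qed
    ultimately have "(\<Sum>p<k. b p (\<sigma> p)) < (\<Sum>p<k. b p (\<tau> p))" by (rule opt)
    moreover have "(\<Sum>i<k. b i (\<rho> i)) = b p (\<rho> p) + (b q (\<rho> q) + (\<Sum>i\<in>{..<k} - {p} - {q}. b i (\<rho> i)))" for \<rho>
      using pqk ne by (subst sum.remove[of _ p]) (auto simp: sum.remove[of "{..<k} - {p}" q])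
    moreover have "(\<Sum>i\<in>{..<k} - {p} - {q}. b i (\<tau> i)) = (\<Sum>i\<in>{..<k} - {p} - {q}. b i (\<sigma> i))"
      by (intro sum.cong) (auto simp: \<tau>_def transpose_def)
    moreover have "b p (\<tau> p) = 0" using zero pqk pq \<sigma>k by (simp add: \<tau>_def)
    moreover have "b q (\<tau> q) < 2"
      using pos[of q "\<sigma> p"] zero[of q "\<sigma> p"] pqk \<sigma>k by (cases "z q (\<sigma> p)") (auto simp: \<tau>_def)
    moreover have "1 < b p (\<sigma> p)" "1 < b q (\<sigma> q)" using pos pq \<sigma>k by (auto simp: R_def)
    ultimately show False by auto
  qed
  moreover have "k = card P + card R" using split card_Un_disjoint[OF fin] by (metis card_lessThan)
  ultimately have cP: "2 * c \<le> card P" using k by linarith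
  \<comment> \<open>Edges go from \<open>v\<close> to \<open>w\<close> when
    \<open>z v (\<sigma> w)\<close>. If every vertex of \<open>Q\<close> had an edge to another one
    in \<open>Q\<close>, rerouting \<open>\<sigma>\<close> along such edges would exchange zeros for
    zeros and give a second permutation of the same weight.\<close>
  have sink: "\<exists>v\<in>Q. \<forall>w\<in>Q - {v}. \<not> z v (\<sigma> w)" if Q: "Q \<subseteq> P" "Q \<noteq> {}" for Q
  proof (rule ccontr)
    assume "\<not> ?thesis"
    then have "\<forall>v\<in>Q. \<exists>w. w \<in> Q \<and> w \<noteq> v \<and> z v (\<sigma> w)" by blast
    then obtain f where f: "\<And>v. v \<in> Q \<Longrightarrow> f v \<in> Q \<and> f v \<noteq> v \<and> z v (\<sigma> (f v))" by metis
    have "finite Q" using Q fin finite_subset by blast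
    then obtain S where S: "S \<subseteq> Q" "S \<noteq> {}" "bij_betw f S S"
      using permutation_on_subset_of_self_map[of Q f] Q f by blast
    define \<pi> where "\<pi> v = (if v \<in> S then f v else v)" for v
    have "bij_betw \<pi> S S" using S(3) by (rule bij_betw_cong[THEN iffD1, rotated]) (simp add: \<pi>_def)
    then have "\<pi> permutes S" by (rule bij_imp_permutes) (simp add: \<pi>_def)
    then have "\<pi> permutes {..<k}" by (rule permutes_subset) (use S Q split in blast)
    then have "\<sigma> \<circ> \<pi> permutes {..<k}" using perm by (rule permutes_compose)
    moreover have "\<sigma> \<circ> \<pi> \<noteq> \<sigma>"
    proof
      assume eq: "\<sigma> \<circ> \<pi> = \<sigma>"
      obtain v where v: "v \<in> S" using S by blast
      then have "\<sigma> (f v) = \<sigma> v" using fun_cong[OF eq, of v] by (simp add: \<pi>_def)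
      then show False using injD[OF inj\<sigma>] f v S by blast
    qed
    ultimately have "(\<Sum>p<k. b p (\<sigma> p)) < (\<Sum>p<k. b p ((\<sigma> \<circ> \<pi>) p))" by (rule opt)
    moreover have "(\<Sum>p<k. b p (\<sigma> p)) = (\<Sum>p<k. b p ((\<sigma> \<circ> \<pi>) p))"
    proof (rule sum.cong)
      fix p assume "p \<in> {..<k}"
      show "b p (\<sigma> p) = b p ((\<sigma> \<circ> \<pi>) p)"
      proof (cases "p \<in> S")
        case True
        then have "p \<in> P" "f p \<in> P" "z p (\<sigma> (f p))" using S Q f by auto
        then show ?thesis using True zero \<sigma>k by (simp add: P_def \<pi>_def)
      qed (simp add: \<pi>_def)
    qed simp
    ultimately show False by simp
  qed
  \<comment> \<open>As \<open>2 * c \<le> card P\<close>, a closed set of \<open>c\<close> rows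
    leaves at least \<open>c\<close> others in \<open>P\<close>; no edge leads to them, so a
    \<open>c\<close> by \<open>c\<close> rectangle misses the zero positions.\<close>
  obtain S where S: "S \<subseteq> P" "card S = c" "\<forall>v\<in>S. \<forall>w\<in>P - S. \<not> z v (\<sigma> w)"
    using closed_subset_of_card[of P c "\<lambda>v w. z v (\<sigma> w)"] fin sink cP by auto
  have "c \<le> card (P - S)" using S cP fin by (simp add: card_Diff_subset finite_subset)
  then obtain S' where S': "S' \<subseteq> P - S" "card S' = c" by (meson obtain_subset_with_card_n)
  have "\<exists>p\<in>S. \<exists>q\<in>S'. z p (\<sigma> q)" using S S' split by (intro hit\<sigma>) auto
  then show False using S S' by blast
qed

section \<open>From optimal permutations to the tropical rank\<close>

lemma tropical_rank_attained:
  obtains I J where "I \<subseteq> {..<dim_row A}" "J \<subseteq> {..<dim_col A}"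
    "card I = tropical_rank A" "card J = tropical_rank A" "tropically_nonsingular (submatrix A I J)"
proof -
  let ?M = "{m. \<exists>I J. I \<subseteq> {..<dim_row A} \<and> J \<subseteq> {..<dim_col A} \<and>
    card I = m \<and> card J = m \<and> tropically_nonsingular (submatrix A I J)}"
  have "0 \<in> ?M" using tropically_nonsingular_empty[of A] by (auto intro!: exI[of _ "{}"])
  then have "tropical_rank A \<in> ?M"
    unfolding tropical_rank_def by (intro Max_in tropical_rank_finite) blast
  then show thesis using that by blast
qed

lemma tropical_rank_le_dim_row: "tropical_rank A \<le> dim_row A"
  by (rule tropical_rank_attained[of A]) (metis card_lessThan card_mono finite_lessThan)

text \<open>Reindexing by \<open>pick\<close> turns a non-singular submatrix into a real matrix with
  a unique optimal permutation; \<open>pick\<close> is injective, so the hitting property is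
  inherited.\<close>

lemma tropical_rank_less:
  assumes A: "A \<in> carrier_mat n n"
    and zero: "\<And>i j. i < n \<Longrightarrow> j < n \<Longrightarrow> (i, j) \<in> Z \<Longrightarrow> A $$ (i, j) = 0"
    and pos: "\<And>i j. i < n \<Longrightarrow> j < n \<Longrightarrow> (i, j) \<notin> Z \<Longrightarrow> 1 < A $$ (i, j) \<and> A $$ (i, j) < 2"
    and hit: "\<And>I J. I \<subseteq> {..<n} \<Longrightarrow> J \<subseteq> {..<n} \<Longrightarrow> card I = c \<Longrightarrow> card J = c \<Longrightarrow> I \<times> J \<inter> Z \<noteq> {}"
  shows "tropical_rank A < 3 * c"
proof -
  have main: "card I < 3 * c"
    if I: "I \<subseteq> {..<n}" and J: "J \<subseteq> {..<n}" and IJ: "card J = card I"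
      and ns: "tropically_nonsingular (submatrix A I J)" for I J
  proof -
    define k where "k = card I"
    define B where "B = submatrix A I J"
    have "{i. i < n \<and> i \<in> I} = I" "{j. j < n \<and> j \<in> J} = J" using I J by auto
    then have cI: "card {i. i < n \<and> i \<in> I} = k" "card {j. j < n \<and> j \<in> J} = k"
      using IJ by (simp_all add: k_def)
    have dim: "dim_row B = k" using A cI by (simp add: B_def dim_submatrix)
    have Bpq: "B $$ (p, q) = A $$ (pick I p, pick J q)" if "p < k" "q < k" for p q
      unfolding B_def using A cI that by (intro submatrix_index) auto
    have pI: "pick I p \<in> I" "pick J p \<in> J" "pick I p < n" "pick J p < n" if "p < k" for p
      using pick_in_set_le[of p I] pick_in_set_le[of p J] that I J IJ by (auto simp: k_def)
    have inj: "inj_on (pick I) {..<k}" "inj_on (pick J) {..<k}"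
      using IJ by (auto intro!: inj_onI simp: k_def) (metis card_pick_le)+
    define b where "b p q = real_of_ereal (B $$ (p, q))" for p q
    define z where "z p q \<longleftrightarrow> (pick I p, pick J q) \<in> Z" for p q
    have ent: "B $$ (p, q) = ereal (b p q) \<and> (if z p q then b p q = 0 else 1 < b p q \<and> b p q < 2)"
      if "p < k" "q < k" for p q
    proof (cases "z p q")
      case True
      then show ?thesis using Bpq[OF that] zero pI[OF that(1)] pI[OF that(2)] by (simp add: b_def z_def)
    next
      case False
      then have "1 < B $$ (p, q)" "B $$ (p, q) < 2"
        using Bpq[OF that] pos pI[OF that(1)] pI[OF that(2)] by (auto simp: z_def)
      then show ?thesis using False by (cases "B $$ (p, q)") (auto simp: b_def)
    qed
    have pw: "perm_weight B \<tau> = ereal (\<Sum>p<k. b p (\<tau> p))" if "\<tau> permutes {..<k}" for \<tau>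
    proof -
      have "perm_weight B \<tau> = (\<Sum>p<k. ereal (b p (\<tau> p)))"
        unfolding perm_weight_def dim
        using ent permutes_in_image[OF that] by (intro sum.cong) auto
      then show ?thesis by simp
    qed
    obtain \<sigma> where \<sigma>: "\<sigma> permutes {..<k}" "perm_weight B \<sigma> = tropical_det B"
      "\<And>\<tau>. \<tau> permutes {..<k} \<Longrightarrow> perm_weight B \<tau> = tropical_det B \<Longrightarrow> \<tau> = \<sigma>"
      using ns unfolding tropically_nonsingular_def B_def[symmetric] dim by blast
    have "k < 3 * c"
    proof (rule unique_optimum_card_less[where b = b and z = z and \<sigma> = \<sigma>])
      show "(\<Sum>p<k. b p (\<sigma> p)) < (\<Sum>p<k. b p (\<tau> p))" if \<tau>: "\<tau> permutes {..<k}" "\<tau> \<noteq> \<sigma>" for \<tau>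
      proof -
        have "tropical_det B \<le> perm_weight B \<tau>"
          unfolding tropical_det_def dim
          using \<tau> by (intro Min_le finite_imageI finite_permutations imageI) auto
        then have "perm_weight B \<sigma> < perm_weight B \<tau>" using \<sigma> \<tau> by (metis order_le_less)
        then show ?thesis using pw \<sigma>(1) \<tau>(1) by simp
      qed
      show "\<exists>p\<in>I'. \<exists>q\<in>J'. z p q"
        if "I' \<subseteq> {..<k}" "J' \<subseteq> {..<k}" "card I' = c" "card J' = c" for I' J'
      proof -
        have "card (pick I ` I') = c" "card (pick J ` J') = c"
          using that inj by (auto simp: card_image inj_on_subset)
        moreover have "pick I ` I' \<subseteq> {..<n}" "pick J ` J' \<subseteq> {..<n}" using pI that by auto
        ultimately have "pick I ` I' \<times> pick J ` J' \<inter> Z \<noteq> {}" by (intro hit)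
        then show ?thesis by (auto simp: z_def)
      qed
    qed (use ent \<sigma>(1) in \<open>auto split: if_splits\<close>)
    then show ?thesis by (simp add: k_def)
  qed
  obtain I J where "I \<subseteq> {..<n}" "J \<subseteq> {..<n}" "card I = tropical_rank A" "card J = tropical_rank A"
    "tropically_nonsingular (submatrix A I J)" using tropical_rank_attained[of A] A by auto
  then show ?thesis using main[of I J] by simp
qed

section \<open>Hitting sets\<close>

text \<open>Greedy choice: by averaging, some element lies in at least a fraction
  \<open>d / card U\<close> of the sets not yet met, so each step multiplies their number by at most
  \<open>1 - d / card U\<close>.\<close>

lemma hitting_set_exists:
  fixes F :: "'a set set"
  assumes U: "finite U" and F: "finite F"
    and sub: "\<And>X. X \<in> F \<Longrightarrow> X \<subseteq> U" and d: "\<And>X. X \<in> F \<Longrightarrow> d \<le> card X"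
  shows "\<exists>H\<subseteq>U. card H \<le> s \<and>
    real (card {X \<in> F. X \<inter> H = {}}) \<le> real (card F) * (1 - real d / real (card U)) ^ s"
proof (induction s)
  case 0
  then show ?case by (intro exI[of _ "{}"]) simp
next
  case (Suc s)
  then obtain H where H: "H \<subseteq> U" "card H \<le> s"
    "real (card {X \<in> F. X \<inter> H = {}}) \<le> real (card F) * (1 - real d / real (card U)) ^ s" by blast
  define G where "G = {X \<in> F. X \<inter> H = {}}"
  show ?case
  \<comment> \<open>With nothing left to meet, only the sign of the bound matters; for empty
    \<open>U\<close> the quotient is 0 by convention and the bound stays the same.\<close>
  proof (cases "G = {} \<or> U = {}")
    case True
    then show ?thesis
    proof (elim disjE)
      assume "G = {}"
      have "d \<le> card U" if "F \<noteq> {}" using that d sub card_mono[OF U] by (meson ex_in_conv order_trans)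
      then have "0 \<le> real (card F) * (1 - real d / real (card U)) ^ Suc s"
        by (cases "F = {}") (auto intro!: mult_nonneg_nonneg zero_le_power simp: divide_le_eq_1)
      moreover have "card {X \<in> F. X \<inter> H = {}} = 0" using \<open>G = {}\<close> by (simp only: G_def card.empty)
      ultimately show ?thesis using H by (intro exI[of _ H]) linarith
    qed (use H in \<open>auto intro!: exI[of _ H]\<close>)
  next
    case False
    have fG: "finite G" using F by (simp add: G_def)
    have Upos: "0 < card U" using False U by (simp add: card_gt_0_iff)
    obtain X0 where "X0 \<in> F" using False by (auto simp: G_def)
    then have dle: "d \<le> card U" using d[of X0] card_mono[OF U sub[of X0]] by simp
    \<comment> \<open>Double counting of the pairs of a set in \<open>G\<close> and one of its
      elements.\<close>
    have "real d * real (card G) = (\<Sum>X\<in>G. real d)" by simp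
    also have "\<dots> \<le> (\<Sum>X\<in>G. real (card X))" using d by (intro sum_mono) (auto simp: G_def)
    also have "\<dots> = (\<Sum>X\<in>G. \<Sum>u\<in>U. if u \<in> X then 1 else 0)"
      using sub U by (intro sum.cong) (auto simp: G_def sum.If_cases Int_absorb1)
    also have "\<dots> = (\<Sum>u\<in>U. \<Sum>X\<in>G. if u \<in> X then 1 else 0)" by (rule sum.swap)
    also have "\<dots> = (\<Sum>u\<in>U. real (card {X \<in> G. u \<in> X}))"
      using fG by (intro sum.cong) (auto simp: sum.If_cases Int_def)
    finally have avg: "real d * real (card G) \<le> (\<Sum>u\<in>U. real (card {X \<in> G. u \<in> X}))" .
    have "\<exists>u\<in>U. real d * real (card G) / real (card U) \<le> real (card {X \<in> G. u \<in> X})"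
    proof (rule ccontr)
      assume "\<not> ?thesis"
      then have "(\<Sum>u\<in>U. real (card {X \<in> G. u \<in> X})) < (\<Sum>u\<in>U. real d * real (card G) / real (card U))"
        using False U by (intro sum_strict_mono) (auto simp: not_le)
      then show False using avg Upos by simp
    qed
    then obtain u where u: "u \<in> U" "real d * real (card G) / real (card U) \<le> real (card {X \<in> G. u \<in> X})"
      by blast
    have "{X \<in> F. X \<inter> insert u H = {}} = G - {X \<in> G. u \<in> X}" by (auto simp: G_def)
    then have "real (card {X \<in> F. X \<inter> insert u H = {}}) = real (card G) - real (card {X \<in> G. u \<in> X})"
      using fG card_mono[OF fG, of "{X \<in> G. u \<in> X}"] by (simp add: card_Diff_subset of_nat_diff)
    also have "\<dots> \<le> real (card G) * (1 - real d / real (card U))" using u by (simp add: algebra_simps)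
    also have "\<dots> \<le> real (card F) * (1 - real d / real (card U)) ^ s * (1 - real d / real (card U))"
      using H(3) dle Upos unfolding G_def by (intro mult_right_mono) auto
    finally have "real (card {X \<in> F. X \<inter> insert u H = {}}) \<le> real (card F) * (1 - real d / real (card U)) ^ Suc s"
      by (simp add: algebra_simps)
    moreover have "card (insert u H) \<le> Suc s" 
      using H(1,2) finite_subset[OF _ U] by (simp add: card_insert_if)
    ultimately show ?thesis using u H by (intro exI[of _ "insert u H"]) auto
  qed
qed

text \<open>At most \<open>n ^ (2 * c)\<close> rectangles are to be met, each with
  \<open>c * c\<close> of the \<open>n * n\<close> positions. The hypothesis, multiplied by
  \<open>c\<close>, makes the greedy bound on those missed after \<open>s\<close> choices less than
  1.\<close>

lemma sparse_set_hitting_squares: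
  assumes n: "0 < n" and s: "2 * ln (real n) * (real n)\<^sup>2 < real c * real s"
  shows "\<exists>Z\<subseteq>{..<n} \<times> {..<n}. card Z \<le> s \<and>
    (\<forall>I J. I \<subseteq> {..<n} \<longrightarrow> J \<subseteq> {..<n} \<longrightarrow> card I = c \<longrightarrow> card J = c \<longrightarrow> I \<times> J \<inter> Z \<noteq> {})"
proof (cases "c \<le> n")
  case False
  then have "card I \<noteq> c" if "I \<subseteq> {..<n}" for I using card_mono[OF _ that] by auto
  then show ?thesis by (intro exI[of _ "{}"]) auto
next
  case True
  \<comment> \<open>For \<open>c = 0\<close> the hypothesis would make \<open>ln (real n)\<close>
    negative.\<close>
  have c: "0 < c" using s n by (cases "c = 0") (auto simp: mult_less_0_iff not_less)
  let ?S = "{I. I \<subseteq> {..<n} \<and> card I = c}"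
  define F where "F = (\<lambda>(I, J). I \<times> J) ` (?S \<times> ?S)"
  have fS: "finite ?S" by simp
  have "card ?S = n choose c" using n_subsets[of "{..<n}" c] by simp
  then have cS: "card ?S \<le> n ^ c" using binomial_le_pow[OF True] by simp
  have "card F \<le> card (?S \<times> ?S)" unfolding F_def using fS by (intro card_image_le) blast
  also have "\<dots> \<le> n ^ c * n ^ c" unfolding card_cartesian_product using cS by (intro mult_le_mono)
  finally have "real (card F) \<le> real (n ^ c * n ^ c)" using of_nat_le_iff by blast
  also have "\<dots> = exp (ln (real n)) ^ (2 * c)" using n by (simp add: mult_2 power_add)
  also have "\<dots> = exp (2 * real c * ln (real n))" by (simp flip: exp_of_nat_mult)
  finally have cF: "real (card F) \<le> exp (2 * real c * ln (real n))" .
  define q where "q = real (c\<^sup>2) / (real n)\<^sup>2"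
  obtain Z where Z: "Z \<subseteq> {..<n} \<times> {..<n}" "card Z \<le> s"
    "real (card {X \<in> F. X \<inter> Z = {}}) \<le> real (card F) * (1 - q) ^ s"
  proof -
    have "X \<subseteq> {..<n} \<times> {..<n} \<and> c\<^sup>2 \<le> card X" if "X \<in> F" for X
      using that by (auto simp: F_def card_cartesian_product power2_eq_square)
    moreover have "finite F" using fS unfolding F_def by blast
    ultimately show ?thesis
      using hitting_set_exists[of "{..<n} \<times> {..<n}" F "c\<^sup>2" s] that
      by (auto simp: q_def card_cartesian_product simp flip: power2_eq_square)
  qed
  have q: "0 \<le> 1 - q"
    using True n by (simp add: q_def divide_le_eq power_mono)
  have "(1 - q) ^ s \<le> exp (- q) ^ s"
    using exp_ge_add_one_self[of "- q"] q by (intro power_mono) auto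
  also have "\<dots> = exp (- (real s * q))" by (simp flip: exp_of_nat_mult)
  finally have "real (card F) * (1 - q) ^ s \<le> exp (2 * real c * ln (real n)) * exp (- (real s * q))"
    using cF q by (intro mult_mono) auto
  also have "\<dots> = exp (2 * real c * ln (real n) - real s * q)" by (simp add: exp_diff exp_minus field_simps)
  also have "\<dots> < 1"
  proof -
    have "real c * (2 * ln (real n) * (real n)\<^sup>2) < real c * (real c * real s)"
      using s c by (intro mult_strict_left_mono) auto
    then have "2 * real c * ln (real n) < real s * q"
      using n by (simp add: q_def field_simps power2_eq_square)
    then show ?thesis by simp
  qed
  finally have "card {X \<in> F. X \<inter> Z = {}} = 0" using Z(3) by linarith
  moreover have "finite F" using fS by (simp add: F_def)
  ultimately have none: "{X \<in> F. X \<inter> Z = {}} = {}" by simp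
  have "I \<times> J \<inter> Z \<noteq> {}" if "I \<subseteq> {..<n}" "J \<subseteq> {..<n}" "card I = c" "card J = c" for I J
  proof -
    have "I \<times> J \<in> F" unfolding F_def using that by (intro image_eqI[of _ _ "(I, J)"]) auto
    then show ?thesis using none by blast
  qed
  then show ?thesis using Z by blast
qed

section \<open>Tropical rank versus Kapranov rank\<close>

theorem theorem2:
  fixes n :: nat and \<alpha> :: real
  assumes "n > 1000" and "0 < \<alpha>" and "\<alpha> < 0.1"
  shows "\<exists>A \<in> tropical_mat n n.
    real (tropical_rank A) \<le> 4 * sqrt (real n) * ln (real n) / \<alpha>\<^sup>2 \<and>
    real (kapranov_rank TYPE('f::field) A) \<ge> real n * (1 - \<alpha>)"
proof -
  define bd where "bd = 4 * sqrt (real n) * ln (real n) / \<alpha>\<^sup>2"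
  have sq: "0 < \<alpha>\<^sup>2" "\<alpha>\<^sup>2 \<le> 1" using assms by (auto simp: power_le_one)
  have ln: "1 \<le> ln (real n)"
    using assms(1) exp_le by (subst ln_ge_iff) auto
  have sqrt: "31 \<le> sqrt (real n)" using assms(1) by (intro real_le_rsqrt) simp
  have "\<exists>Z\<subseteq>{..<n} \<times> {..<n}. real (card Z) \<le> \<alpha>\<^sup>2 * (real n)\<^sup>2 \<and> (real n \<le> bd \<or>
    (\<exists>c>0. real (3 * c) \<le> bd \<and>
    (\<forall>I J. I \<subseteq> {..<n} \<longrightarrow> J \<subseteq> {..<n} \<longrightarrow> card I = c \<longrightarrow> card J = c \<longrightarrow> I \<times> J \<inter> Z \<noteq> {})))"
  \<comment> \<open>If \<open>n\<close> is at most \<open>bd\<close>, the dimension already bounds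
    the tropical rank and \<open>Z\<close> may be empty.\<close>
  proof (cases "real n \<le> bd")
    case True
    then show ?thesis by (intro exI[of _ "{}"]) auto
  next
    case False
    define x where "x = ln (real n) / \<alpha>\<^sup>2"
    \<comment> \<open>\<open>c\<close> just exceeds \<open>4 * x\<close>, and \<open>s\<close> is
      the allowed number of zeros rounded down. As \<open>s\<close> keeps more than half of that
      number, \<open>c * s\<close> exceeds the \<open>2 * ln n * n^2\<close> needed for
      hitting.\<close>
    define c where "c = nat \<lfloor>4 * x\<rfloor> + 1"
    define s where "s = nat \<lfloor>\<alpha>\<^sup>2 * (real n)\<^sup>2\<rfloor>"
    have x: "1 \<le> x" using ln sq by (simp add: x_def le_divide_eq)
    have c: "4 * x < real c" "real c \<le> 4 * x + 1" using x unfolding c_def by linarith+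
    \<comment> \<open>The failure of the first case makes \<open>\<alpha>\<close> large enough for
      \<open>2 \<le> \<alpha>^2 * n^2\<close>, so rounding down loses less than half.\<close>
    have "bd < real n" using False by simp
    then have "4 * sqrt (real n) * ln (real n) < \<alpha>\<^sup>2 * real n"
      using sq by (simp add: bd_def divide_less_eq mult.commute)
    moreover have "1 * 1 \<le> sqrt (real n) * ln (real n)"
      using sqrt ln assms(1) by (intro mult_mono) auto
    ultimately have "2 * 1 \<le> (\<alpha>\<^sup>2 * real n) * real n" using assms(1) by (intro mult_mono) auto
    then have "2 \<le> \<alpha>\<^sup>2 * (real n)\<^sup>2" by (simp add: power2_eq_square mult.assoc)
    then have s: "\<alpha>\<^sup>2 * (real n)\<^sup>2 / 2 < real s" "real s \<le> \<alpha>\<^sup>2 * (real n)\<^sup>2"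
      unfolding s_def by linarith+
    have "2 * ln (real n) * (real n)\<^sup>2 = 4 * x * (\<alpha>\<^sup>2 * (real n)\<^sup>2 / 2)"
      using sq by (simp add: x_def)
    also have "\<dots> < real c * real s" using c(1) s(1) x sq by (intro mult_strict_mono) auto
    finally obtain Z where Z: "Z \<subseteq> {..<n} \<times> {..<n}" "card Z \<le> s"
      "\<forall>I J. I \<subseteq> {..<n} \<longrightarrow> J \<subseteq> {..<n} \<longrightarrow> card I = c \<longrightarrow> card J = c \<longrightarrow> I \<times> J \<inter> Z \<noteq> {}"
      using sparse_set_hitting_squares[of n c s] assms(1) by auto
    \<comment> \<open>Since \<open>1 \<le> x\<close>, this is at most \<open>15 * x\<close>, and
      \<open>4 * sqrt n\<close> is at least \<open>4 * 31\<close>.\<close>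
    have "real (3 * c) \<le> 12 * x + 3" using c by simp
    also have "\<dots> \<le> (4 * sqrt (real n)) * x"
    proof -
      have "(4 * 31) * x \<le> (4 * sqrt (real n)) * x" using sqrt x by (intro mult_right_mono) auto
      then show ?thesis using x by linarith
    qed
    also have "\<dots> = bd" by (simp add: bd_def x_def)
    finally have "real (3 * c) \<le> bd" .
    moreover have "0 < c" by (simp add: c_def)
    moreover have "real (card Z) \<le> \<alpha>\<^sup>2 * (real n)\<^sup>2" using Z(2) s(2) by linarith
    ultimately show ?thesis using Z by blast
  qed
  then obtain Z where Z: "Z \<subseteq> {..<n} \<times> {..<n}" "real (card Z) \<le> \<alpha>\<^sup>2 * (real n)\<^sup>2"
    and bound: "real n \<le> bd \<or> (\<exists>c>0. real (3 * c) \<le> bd \<and>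
    (\<forall>I J. I \<subseteq> {..<n} \<longrightarrow> J \<subseteq> {..<n} \<longrightarrow> card I = c \<longrightarrow> card J = c \<longrightarrow> I \<times> J \<inter> Z \<noteq> {}))"
    by blast
  define T where "T = {..<n} \<times> {..<n} - Z"
  have "finite T" by (simp add: T_def)
  then obtain g where g: "\<And>t. t \<in> T \<Longrightarrow> 1 < g t \<and> g t < (2 :: real)"
    "\<And>e e' :: nat \<times> nat \<Rightarrow> nat.
      (\<Sum>t\<in>T. real (e t) * g t) = (\<Sum>t\<in>T. real (e' t) * g t) \<Longrightarrow> \<forall>t\<in>T. e t = e' t"
    using generic_reals_exist[of T 1 2] by auto
  define A where "A = mat n n (\<lambda>t. if t \<in> Z then 0 else ereal (g t))"
  have A: "A \<in> carrier_mat n n" "A \<in> tropical_mat n n" by (auto simp: A_def tropical_mat_def)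
  have "real (tropical_rank A) \<le> bd"
    using bound
  proof (elim disjE exE conjE)
    assume "real n \<le> bd"
    then show ?thesis using tropical_rank_le_dim_row[of A] A(1) by simp
  next
    fix c assume c: "0 < c" "real (3 * c) \<le> bd"
      "\<forall>I J. I \<subseteq> {..<n} \<longrightarrow> J \<subseteq> {..<n} \<longrightarrow> card I = c \<longrightarrow> card J = c \<longrightarrow> I \<times> J \<inter> Z \<noteq> {}"
    have "tropical_rank A < 3 * c"
    proof (rule tropical_rank_less[OF A(1)])
      show "1 < A $$ (i, j) \<and> A $$ (i, j) < 2" if "i < n" "j < n" "(i, j) \<notin> Z" for i j
        using g(1)[of "(i, j)"] that by (simp add: A_def T_def)
    qed (use c in \<open>auto simp: A_def\<close>)
    then show ?thesis using c(2) by linarith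
  qed
  moreover have "real n * (1 - \<alpha>) \<le> real (kapranov_rank TYPE('f) A)"
  proof -
    define r where "r = kapranov_rank TYPE('f) A"
    have "card T + (n - r)\<^sup>2 \<le> n\<^sup>2"
      unfolding r_def
      by (rule kapranov_rank_lower_bound[OF A(2), where g = g]) (use g(2) in \<open>auto simp: T_def A_def\<close>)
    moreover have "card T + card Z = n\<^sup>2"
      using Z(1) card_mono[OF _ Z(1)] finite_subset[OF Z(1)]
      by (simp add: T_def card_Diff_subset power2_eq_square)
    ultimately have "(n - r)\<^sup>2 \<le> card Z" by linarith
    then have "real ((n - r)\<^sup>2) \<le> real (card Z)" by (rule of_nat_mono)
    then have "(real (n - r))\<^sup>2 \<le> (\<alpha> * real n)\<^sup>2" using Z(2) by (simp only: power_mult_distrib of_nat_power)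
    \<comment> \<open>The truncated difference is at least the real one, so a bound on it
      suffices.\<close>
    then have "real (n - r) \<le> \<alpha> * real n" by (rule power2_le_imp_le) (use assms in simp)
    then show ?thesis unfolding r_def by (simp add: algebra_simps)
  qed
  ultimately show ?thesis using A(2) unfolding bd_def by blast
qed

end
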